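(* Let $n\ge 2$, $\gamma\in\mathbb{C}\setminus\{0\}$, and let $A_{12}(u,v;\lambda)$, $B_{12}(v;\lambda)$, $C_{12}(u;\lambda)$, $D_{12}(u-v;\lambda)$ be the rational non-constant Arutyunov-Chekhov-Frolov structure matrices defined in the context. Let $f=f(\lambda)$ be a meromorphic function that is $\gamma$-periodic in each $\lambda_i$. Consider the semi-dynamical reflection equation $$A_{12}(u,v;\lambda)\,K_1(u;\lambda)\,B_{12}(v;\lambda)\,K_2(v;\lambda+\gamma h_1)=K_2(v;\lambda)\,C_{12}(u;\lambda)\,K_1(u;\lambda+\gamma h_2)\,D_{12}(u-v;\lambda)\qquad(\ast)$$ for an $n\times n$ matrix $K(u;\lambda)$ of the form $K(u;\lambda)=k^{(0)}(\lambda)+\frac{\gamma}{u}\,k^{(1)}(\lambda)$, where $k^{(1)}(\lambda)$ has entries meromorphic in $\lambda$. Assume that $k^{(0)}$ has no entry that is identically zero. (Ib) If $k^{(0)}_{ij}(\lambda)=\frac{f+\Lambda_j}{f+\Lambda_i}\prod_{a\neq j}\frac{\gamma}{\lambda_{ja}}$, with $\Lambda_i=\sum_{a=1}^n\lambda_a-\lambda_i$, then there is exactly one $k^{(1)}$ such that $K$ solves $(\ast)$, and the resulting solution is $$K_{ij}(u;\lambda)=(f+\Lambda_j)\left(\frac{1}{f+\Lambda_i}-\frac1u\right)\prod_{a\neq j}\frac{\gamma}{\lambda_{ja}}.$$ (IIb) If $k^{(0)}_{ij}(\lambda)=\frac{f}{f-\lambda_{ij}}\prod_{a\neq j}\left(1+\frac{f}{\lambda_{ja}}\right)$,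 then there is exactly one $k^{(1)}$ such that $K$ solves $(\ast)$, and the resulting solution is $$K_{ij}(u;\lambda)=f\left(\frac{1}{f-\lambda_{ij}}-\frac1u\right)\prod_{a\neq j}\left(1+\frac{f}{\lambda_{ja}}\right).$$ (Ia, IIa) If either $k^{(0)}_{ij}(\lambda)=\frac{f+\lambda_i}{f+\lambda_j}\prod_{a\neq j}\frac{\gamma}{\lambda_{ja}}$ or $k^{(0)}_{ij}(\lambda)=(f-\Lambda_{ij})\prod_{a\neq j}\frac{\gamma}{\lambda_{ja}}$ with $\Lambda_{ij}=\sum_{a=1}^n\lambda_a-(\lambda_i+\lambda_j)$, then there is no $k^{(1)}$ such that $K$ solves $(\ast)$. In all these cases, $k^{(1)}$ is not allowed to have a zero column.
   Context: Notation: $\lambda=(\lambda_1,\dots,\lambda_n)$ are complex (dynamical) variables, $\lambda_{ij}=\lambda_i-\lambda_j$; $u,v$ are complex spectral parameters; $e_{ij}$ are the standard $n\times n$ matrix units and $h_j=e_{jj}$. For an $n\times n$ matrix $K$, $K_1=K\otimes 1$, $K_2=1\otimes K$, and dynamical shifts mean $K_2(v;\lambda+\gamma h_1)=\sum_{j}e_{jj}\otimes K(v;\lambda+\gamma\varepsilon_j)$, $K_1(u;\lambda+\gamma h_2)=\sum_j K(u;\lambda+\gamma\varepsilon_j)\otimes e_{jj}$, where $\lambda+\gamma\varepsilon_j$ is $\lambda$ with $\lambda_j$ replaced by $\lambda_j+\gamma$. For a matrix $M_{12}=\sum a\otimes b$, $M_{21}=\sum b\otimes a$. All identities are identities of meromorphic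 functions in $\lambda,u,v$. The rational non-constant Arutyunov-Chekhov-Frolov (ACF) structure matrices are $$A_{12}(u,v;\lambda)=A^\infty_{12}(\lambda)+\frac{\gamma}{u-v}d_{12}+\frac{\gamma}{v}b_{12}-\frac{\gamma}{u+\gamma}b_{21},$$ $$B_{12}(v;\lambda)=B^\infty_{12}(\lambda)-\frac{\gamma}{v+\gamma}b_{12},\qquad C_{12}(u;\lambda)=B_{21}(u;\lambda)=B^\infty_{21}(\lambda)-\frac{\gamma}{u+\gamma}b_{21},$$ $$D_{12}(u-v;\lambda)=D^\infty_{12}(\lambda)+\frac{\gamma}{u-v}d_{12},$$ where $d_{12}=\sum_{i,j}e_{ij}\otimes e_{ji}$, $b_{12}=\sum_{i,j}e_{ii}\otimes e_{ji}$ and $$A^\infty_{12}=1\otimes1+\sum_{i\neq j}\frac{\gamma}{\lambda_{ij}}(e_{ii}-e_{ij})\otimes(e_{jj}-e_{ji}),$$ $$B^\infty_{12}=1\otimes1+\sum_{i\neq j}\frac{\gamma}{\lambda_{ij}-\gamma}\,e_{jj}\otimes(e_{ii}-e_{ij}),$$ $$D^\infty_{12}=1\otimes1+\sum_{i\neq j}\frac{\gamma}{\lambda_{ij}}(e_{ij}\otimes e_{ji}-e_{ii}\otimes e_{jj}).$$ The four matrices $k^{(0)}$ in the claim are known solutions of the constant equation obtained from $(\ast)$ as $u,v,u-v\to\infty$.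
   Formalization: The nonexistence claims (Ia, IIa) are stated for n ≥ 3 only: at n = 2 the leading term Ia equals Ib and IIa equals γ times IIb, so by (Ib), (IIb) and invariance of (∗) under scaling K solutions exist and the claim is false. *)

theory Defs
  imports "HOL-Analysis.Analysis"
begin

section \<open>Meromorphic functions of several variables\<close>

text \<open>
  Meromorphic functions are represented by total functions whose values on a nowhere dense set
  (poles, points of indeterminacy) are irrelevant. Accordingly, every identity between
  meromorphic functions is read as an identity that holds on some open dense set.
\<close>

definition generic :: "('a::topological_space \<Rightarrow> bool) \<Rightarrow> bool" where
  "generic P \<longleftrightarrow> (\<exists>S. open S \<and> closure S = UNIV \<and> (\<forall>x\<in>S. P x))"

definition holomorphic_Cn_on :: "(complex^'n \<Rightarrow> complex) \<Rightarrow> (complex^'n) set \<Rightarrow> bool" where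
  "holomorphic_Cn_on g U \<longleftrightarrow>
     (\<forall>x\<in>U. \<exists>g'. (g has_derivative g') (at x) \<and> (\<forall>c v. g' (c *s v) = c * g' v))"

text \<open>
  The density condition says that the denominator vanishes identically on no nonempty open
  subset of \<open>U\<close>, that is, it is not a zero divisor in the ring of germs at any point of \<open>U\<close>.
\<close>

definition meromorphic_Cn :: "(complex^'n \<Rightarrow> complex) \<Rightarrow> bool" where
  "meromorphic_Cn f \<longleftrightarrow>
     (\<forall>p. \<exists>U g h. open U \<and> p \<in> U \<and> holomorphic_Cn_on g U \<and> holomorphic_Cn_on h U \<and>
        U \<subseteq> closure {x\<in>U. h x \<noteq> 0} \<and> (\<forall>x\<in>U. h x \<noteq> 0 \<longrightarrow> f x = g x / h x))"

definition meromorphic_mat :: "(complex^'n \<Rightarrow> complex^'n^'n) \<Rightarrow> bool" where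
  "meromorphic_mat k \<longleftrightarrow> (\<forall>i j. meromorphic_Cn (\<lambda>l. k l $ i $ j))"

definition no_zero_entry :: "(complex^'n \<Rightarrow> complex^'n^'n) \<Rightarrow> bool" where
  "no_zero_entry k \<longleftrightarrow> (\<forall>i j. \<not> generic (\<lambda>l. k l $ i $ j = 0))"

definition no_zero_column :: "(complex^'n \<Rightarrow> complex^'n^'n) \<Rightarrow> bool" where
  "no_zero_column k \<longleftrightarrow> (\<forall>j. \<not> generic (\<lambda>l. column j (k l) = 0))"


section \<open>Matrices on the tensor square\<close>

text \<open>Endomorphisms of the tensor square of \<open>\<complex>\<^sup>n\<close> are matrices indexed by pairs.\<close>

type_synonym 'n mat2 = "complex^('n \<times> 'n)^('n \<times> 'n)"

definition mscale :: "complex \<Rightarrow> complex^'m^'n \<Rightarrow> complex^'m^'n" (infixr "*\<^sub>c" 75) where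
  "c *\<^sub>c M = (\<chi> i j. c * M $ i $ j)"

definition kron :: "complex^'n^'n \<Rightarrow> complex^'n^'n \<Rightarrow> 'n mat2" (infix "\<otimes>\<^sub>K" 72) where
  "X \<otimes>\<^sub>K Y = (\<chi> p q. X $ fst p $ fst q * Y $ snd p $ snd q)"

definition flip :: "'n::finite mat2 \<Rightarrow> 'n mat2" where
  "flip M = (\<chi> p q. M $ prod.swap p $ prod.swap q)"

definition E :: "'n \<Rightarrow> 'n \<Rightarrow> complex^'n^'n" where
  "E i j = (\<chi> a b. if a = i \<and> b = j then 1 else 0)"

definition shift :: "complex \<Rightarrow> complex^'n \<Rightarrow> 'n \<Rightarrow> complex^'n" where
  "shift \<gamma> l j = (\<chi> a. if a = j then l $ a + \<gamma> else l $ a)"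


section \<open>The rational Arutyunov-Chekhov-Frolov structure matrices\<close>

definition d12 :: "'n::finite mat2" where
  "d12 = (\<Sum>i\<in>UNIV. \<Sum>j\<in>UNIV. E i j \<otimes>\<^sub>K E j i)"

definition b12 :: "'n::finite mat2" where
  "b12 = (\<Sum>i\<in>UNIV. \<Sum>j\<in>UNIV. E i i \<otimes>\<^sub>K E j i)"

definition A_inf :: "complex \<Rightarrow> complex^'n::finite \<Rightarrow> 'n mat2" where
  "A_inf \<gamma> l = mat 1 \<otimes>\<^sub>K mat 1
     + (\<Sum>i\<in>UNIV. \<Sum>j\<in>UNIV - {i}.
          (\<gamma> / (l $ i - l $ j)) *\<^sub>c ((E i i - E i j) \<otimes>\<^sub>K (E j j - E j i)))"

definition B_inf :: "complex \<Rightarrow> complex^'n::finite \<Rightarrow> 'n mat2" where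
  "B_inf \<gamma> l = mat 1 \<otimes>\<^sub>K mat 1
     + (\<Sum>i\<in>UNIV. \<Sum>j\<in>UNIV - {i}.
          (\<gamma> / (l $ i - l $ j - \<gamma>)) *\<^sub>c (E j j \<otimes>\<^sub>K (E i i - E i j)))"

definition D_inf :: "complex \<Rightarrow> complex^'n::finite \<Rightarrow> 'n mat2" where
  "D_inf \<gamma> l = mat 1 \<otimes>\<^sub>K mat 1
     + (\<Sum>i\<in>UNIV. \<Sum>j\<in>UNIV - {i}.
          (\<gamma> / (l $ i - l $ j)) *\<^sub>c (E i j \<otimes>\<^sub>K E j i - E i i \<otimes>\<^sub>K E j j))"

definition A12 :: "complex \<Rightarrow> complex \<Rightarrow> complex \<Rightarrow> complex^'n::finite \<Rightarrow> 'n mat2" where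
  "A12 \<gamma> u v l = A_inf \<gamma> l + (\<gamma> / (u - v)) *\<^sub>c d12 + (\<gamma> / v) *\<^sub>c b12
     - (\<gamma> / (u + \<gamma>)) *\<^sub>c flip b12"

definition B12 :: "complex \<Rightarrow> complex \<Rightarrow> complex^'n::finite \<Rightarrow> 'n mat2" where
  "B12 \<gamma> v l = B_inf \<gamma> l - (\<gamma> / (v + \<gamma>)) *\<^sub>c b12"

definition C12 :: "complex \<Rightarrow> complex \<Rightarrow> complex^'n::finite \<Rightarrow> 'n mat2" where
  "C12 \<gamma> u l = flip (B12 \<gamma> u l)"

text \<open>The spectral argument \<open>w\<close> of \<open>D12\<close> stands for the difference \<open>u - v\<close>.\<close>

definition D12 :: "complex \<Rightarrow> complex \<Rightarrow> complex^'n::finite \<Rightarrow> 'n mat2" where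
  "D12 \<gamma> w l = D_inf \<gamma> l + (\<gamma> / w) *\<^sub>c d12"


section \<open>The semi-dynamical reflection equation\<close>

definition in1 :: "complex^'n^'n \<Rightarrow> 'n mat2" where
  "in1 X = X \<otimes>\<^sub>K mat 1"

definition in2 :: "complex^'n^'n \<Rightarrow> 'n mat2" where
  "in2 X = mat 1 \<otimes>\<^sub>K X"

text \<open>
  For \<open>X = K(u; \<cdot>)\<close>: \<open>in1_shifted\<close> is \<open>K\<^sub>1(u; \<lambda> + \<gamma> h\<^sub>2)\<close> and \<open>in2_shifted\<close> is
  \<open>K\<^sub>2(u; \<lambda> + \<gamma> h\<^sub>1)\<close>.
\<close>

definition in1_shifted :: "complex \<Rightarrow> (complex^'n::finite \<Rightarrow> complex^'n^'n) \<Rightarrow> complex^'n \<Rightarrow> 'n mat2"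
  where "in1_shifted \<gamma> X l = (\<Sum>j\<in>UNIV. X (shift \<gamma> l j) \<otimes>\<^sub>K E j j)"

definition in2_shifted :: "complex \<Rightarrow> (complex^'n::finite \<Rightarrow> complex^'n^'n) \<Rightarrow> complex^'n \<Rightarrow> 'n mat2"
  where "in2_shifted \<gamma> X l = (\<Sum>j\<in>UNIV. E j j \<otimes>\<^sub>K X (shift \<gamma> l j))"

definition reflection_eq ::
    "complex \<Rightarrow> (complex \<Rightarrow> complex^'n::finite \<Rightarrow> complex^'n^'n) \<Rightarrow> bool" where
  "reflection_eq \<gamma> K \<longleftrightarrow>
     generic (\<lambda>(u, v, l).
       A12 \<gamma> u v l ** in1 (K u l) ** B12 \<gamma> v l ** in2_shifted \<gamma> (K v) l
       = in2 (K v l) ** C12 \<gamma> u l ** in1_shifted \<gamma> (K u) l ** D12 \<gamma> (u - v) l)"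

definition K_ansatz ::
    "complex \<Rightarrow> (complex^'n \<Rightarrow> complex^'n^'n) \<Rightarrow> (complex^'n \<Rightarrow> complex^'n^'n)
       \<Rightarrow> complex \<Rightarrow> complex^'n \<Rightarrow> complex^'n^'n" where
  "K_ansatz \<gamma> k0 k1 u l = k0 l + (\<gamma> / u) *\<^sub>c k1 l"

definition solves_with ::
    "complex \<Rightarrow> (complex^'n::finite \<Rightarrow> complex^'n^'n) \<Rightarrow> (complex^'n \<Rightarrow> complex^'n^'n) \<Rightarrow> bool" where
  "solves_with \<gamma> k0 k1 \<longleftrightarrow> meromorphic_mat k1 \<and> reflection_eq \<gamma> (K_ansatz \<gamma> k0 k1)"


section \<open>The four leading terms\<close>

definition Lam :: "complex^'n::finite \<Rightarrow> 'n \<Rightarrow> complex" where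
  "Lam l i = (\<Sum>a\<in>UNIV. l $ a) - l $ i"

definition Lam2 :: "complex^'n::finite \<Rightarrow> 'n \<Rightarrow> 'n \<Rightarrow> complex" where
  "Lam2 l i j = (\<Sum>a\<in>UNIV. l $ a) - (l $ i + l $ j)"

definition k0_Ia ::
    "complex \<Rightarrow> (complex^'n::finite \<Rightarrow> complex) \<Rightarrow> complex^'n \<Rightarrow> complex^'n^'n" where
  "k0_Ia \<gamma> f l = (\<chi> i j. (f l + l $ i) / (f l + l $ j) * (\<Prod>a\<in>UNIV - {j}. \<gamma> / (l $ j - l $ a)))"

definition k0_Ib ::
    "complex \<Rightarrow> (complex^'n::finite \<Rightarrow> complex) \<Rightarrow> complex^'n \<Rightarrow> complex^'n^'n" where
  "k0_Ib \<gamma> f l =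
     (\<chi> i j. (f l + Lam l j) / (f l + Lam l i) * (\<Prod>a\<in>UNIV - {j}. \<gamma> / (l $ j - l $ a)))"

definition k0_IIa ::
    "complex \<Rightarrow> (complex^'n::finite \<Rightarrow> complex) \<Rightarrow> complex^'n \<Rightarrow> complex^'n^'n" where
  "k0_IIa \<gamma> f l = (\<chi> i j. (f l - Lam2 l i j) * (\<Prod>a\<in>UNIV - {j}. \<gamma> / (l $ j - l $ a)))"

definition k0_IIb :: "(complex^'n::finite \<Rightarrow> complex) \<Rightarrow> complex^'n \<Rightarrow> complex^'n^'n" where
  "k0_IIb f l =
     (\<chi> i j. f l / (f l - (l $ i - l $ j)) * (\<Prod>a\<in>UNIV - {j}. 1 + f l / (l $ j - l $ a)))"

definition K_Ib ::
    "complex \<Rightarrow> (complex^'n::finite \<Rightarrow> complex) \<Rightarrow> complex \<Rightarrow> complex^'n \<Rightarrow> complex^'n^'n" where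
  "K_Ib \<gamma> f u l =
     (\<chi> i j. (f l + Lam l j) * (1 / (f l + Lam l i) - 1 / u)
        * (\<Prod>a\<in>UNIV - {j}. \<gamma> / (l $ j - l $ a)))"

definition K_IIb ::
    "(complex^'n::finite \<Rightarrow> complex) \<Rightarrow> complex \<Rightarrow> complex^'n \<Rightarrow> complex^'n^'n" where
  "K_IIb f u l =
     (\<chi> i j. f l * (1 / (f l - (l $ i - l $ j)) - 1 / u)
        * (\<Prod>a\<in>UNIV - {j}. 1 + f l / (l $ j - l $ a)))"

text \<open>
  For \<open>n = 2\<close> the types (a) and (b) coincide: the leading terms Ia and Ib are equal, and IIa is
  \<open>\<gamma>\<close> times IIb. As (b) extends to a solution and the reflection equation is
  invariant under rescaling \<open>K\<close> by a nonzero constant, nonexistence for type (a) can hold only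
  for \<open>n \<ge> 3\<close>.
\<close>

lemma two_indices:
  assumes "CARD('n::finite) = 2"
  obtains j' where "UNIV = {j, j'}" "j' \<noteq> (j::'n)"
proof -
  have "card (UNIV - {j}) = 1" using assms by simp
  then obtain j' where "UNIV - {j} = {j'}" by (rule card_1_singletonE)
  then show thesis by (intro that[of j']) auto
qed

lemma k0_Ia_eq_Ib_of_card_2:
  fixes l :: "complex^'n::finite"
  assumes "CARD('n) = 2" "\<And>i. f l + l $ i \<noteq> 0"
  shows "k0_Ia \<gamma> f l = k0_Ib \<gamma> f l"
proof -
  have *: "Lam l i = l $ j" if "i \<noteq> j" for i j
  proof -
    obtain j' where "UNIV = {j, j'}" "j' \<noteq> j" using two_indices[OF assms(1)] by blast
    then have U: "UNIV = {j, i}" using that by auto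
    show ?thesis unfolding Lam_def U using that by simp
  qed
  have "(f l + l $ i) / (f l + l $ j) = (f l + Lam l j) / (f l + Lam l i)" for i j
  proof (cases "i = j")
    case True
    obtain j' where "j' \<noteq> j" using two_indices[OF assms(1)] by blast
    then show ?thesis using True *[of j j'] assms(2) by simp
  next
    case False
    then show ?thesis using *[of i j] *[of j i] by simp
  qed
  then show ?thesis by (simp add: k0_Ia_def k0_Ib_def)
qed

lemma k0_IIa_eq_IIb_of_card_2:
  fixes l :: "complex^'n::finite"
  assumes "CARD('n) = 2" "\<And>i j. i \<noteq> j \<Longrightarrow> l $ i \<noteq> l $ j" "\<And>i j. f l \<noteq> l $ i - l $ j"
  shows "k0_IIa \<gamma> f l = \<gamma> *\<^sub>c k0_IIb f l"
proof -
  have "k0_IIa \<gamma> f l $ i $ j = (\<gamma> *\<^sub>c k0_IIb f l) $ i $ j" for i j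
  proof -
    obtain j' where U: "UNIV = {j, j'}" and j': "j' \<noteq> j"
      using two_indices[OF assms(1)] by blast
    have nz: "l $ j - l $ j' \<noteq> 0" "f l - (l $ j' - l $ j) \<noteq> 0" "f l \<noteq> 0"
      using assms(2)[of j j'] assms(3)[of j' j] assms(3)[of j j] j' by auto
    have P: "(\<Prod>a\<in>UNIV - {j}. g a) = (g j' :: complex)" for g
      unfolding U using j' by (simp add: insert_Diff_if)
    have "i = j \<or> i = j'" using U by auto
    then show ?thesis
    proof
      assume "i = j"
      moreover have "Lam2 l j j = l $ j' - l $ j"
        unfolding Lam2_def U using j' by simp
      moreover have "f l - (l $ j' - l $ j) = (1 + f l / (l $ j - l $ j')) * (l $ j - l $ j')"
        using nz(1) by (simp add: distrib_right)
      ultimately show ?thesis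
        using nz unfolding k0_IIa_def k0_IIb_def mscale_def by (simp add: P)
    next
      assume "i = j'"
      moreover have "Lam2 l j' j = 0"
        unfolding Lam2_def U using j' by simp
      moreover have "1 + f l / (l $ j - l $ j') = (f l - (l $ j' - l $ j)) / (l $ j - l $ j')"
        using nz(1) by (simp add: field_simps)
      ultimately show ?thesis
        using nz unfolding k0_IIa_def k0_IIb_def mscale_def by (simp add: P)
    qed
  qed
  then show ?thesis by (simp add: vec_eq_iff)
qed

end

theory Submission
  imports Defs "HOL-Complex_Analysis.Conformal_Mappings"
begin

text \<open>
  In components, both sides of the reflection equation are built from the products
  \<open>M(u, v)\<^sub>a\<^sub>b\<^sub>p\<^sub>q = K\<^sub>a\<^sub>p(u) G\<^sub>b\<^sub>p\<^sub>q(v)\<close>, where \<open>G\<close> is an entry of \<open>B\<^sub>1\<^sub>2 K\<^sub>2(\<lambda> + \<gamma> h\<^sub>1)\<close>; the right-hand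
  side involves \<open>M(v, u)\<^sub>b\<^sub>a\<^sub>q\<^sub>p\<close>.

  Necessary conditions come from the components \<open>(a, a), (p, p)\<close> alone. For \<open>K = k\<^sub>0 + (\<gamma> / u) k\<^sub>1\<close> they
  separate the variables \<open>u\<close> and \<open>v\<close> and force every column of \<open>k\<^sub>1\<close> to be constant, together with a
  linear relation between \<open>(k\<^sub>1)\<^sub>p\<^sub>p\<close> at \<open>\<lambda>\<close> and at \<open>\<lambda> + \<gamma> \<epsilon>\<^sub>p\<close> for every row \<open>a\<close>. For
  types Ib and IIb two rows determine \<open>k\<^sub>1\<close>. For types Ia and IIa the relation says that a nonzero
  quadratic polynomial vanishes at \<open>n\<close> distinct points, which is impossible for \<open>n \<ge> 3\<close>.

  Conversely, for the claimed solutions \<open>G\<close> factorizes, so that \<open>M\<close> is a product of a factor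
  \<open>1 / x\<^sub>a - 1 / u\<close> and a factor \<open>1 / (x\<^sub>b + \<delta>) - 1 / (v + \<gamma>)\<close>, and all components reduce to one
  identity of rational functions.
\<close>

section \<open>Generic properties\<close>

text \<open>The types (a) and (b) differ in the shape of one column p of \<open>k0\<close>: up to a
  factor independent of the row a it is \<open>1 / y a\<close> for Ib and IIb, but
  \<open>y a\<close> for Ia and IIa, where the numbers \<open>y a\<close> are distinct because their
  differences are \<open>l $ a - l $ b\<close> up to sign. Clearing denominators in the row relation
  leaves two affine functions of \<open>y a\<close> in type (b), so agreement in two rows makes them
  equal and fixes the column. In type (a) it leaves a quadratic whose leading coefficient nothing
  can cancel; two rows may satisfy it, three cannot.

  The diagonal components are so restrictive because the \<lambda>-dependent corrections in A and D
  drop out there, leaving scalar factors in u and v on both sides.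

  Functions are total and identities hold only on open dense sets, so "not identically zero" is too
  weak for division. The identity theorem upgrades it to "nonzero on an open dense set". The
  periodic function f = -\<gamma> in type IIb is admissible and makes several fractions degenerate,
  which explains the case distinctions for that type.\<close>

lemma generic_mono: "generic P \<Longrightarrow> (\<And>x. P x \<Longrightarrow> Q x) \<Longrightarrow> generic Q"
  unfolding generic_def by blast

lemma generic_True: "generic (\<lambda>x. True)"
  unfolding generic_def by (intro exI[of _ UNIV]) auto

lemma closure_Int_open_dense:
  fixes S T :: "'a::topological_space set"
  assumes "open S" "closure S = UNIV" "closure T = UNIV"
  shows "closure (S \<inter> T) = UNIV"
  using open_Int_closure_subset[OF assms(1), of T] assms closure_mono[of S "closure (S \<inter> T)"]
  by auto

lemma generic_conj:
  assumes "generic P" "generic Q"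
  shows "generic (\<lambda>x. P x \<and> Q x)"
proof -
  obtain S T where "open S" "closure S = UNIV" "\<forall>x\<in>S. P x" "open T" "closure T = UNIV" "\<forall>x\<in>T. Q x"
    using assms unfolding generic_def by blast
  then show ?thesis
    unfolding generic_def by (intro exI[of _ "S \<inter> T"]) (auto simp: closure_Int_open_dense)
qed

lemma generic_all_finite:
  assumes "finite A" "\<And>i. i \<in> A \<Longrightarrow> generic (P i)"
  shows "generic (\<lambda>x. \<forall>i\<in>A. P i x)"
  using assms
proof (induction A rule: finite_induct)
  case empty
  show ?case by (simp add: generic_True)
next
  case (insert i A)
  then show ?case by (auto intro: generic_mono[OF generic_conj])
qed

lemma generic_all:
  fixes P :: "'i::finite \<Rightarrow> 'a::topological_space \<Rightarrow> bool"
  shows "(\<And>i. generic (P i)) \<Longrightarrow> generic (\<lambda>x. \<forall>i. P i x)"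
  using generic_all_finite[of UNIV P] by simp

lemma generic_exists:
  fixes P :: "'a::topological_space \<Rightarrow> bool"
  assumes "generic P"
  obtains x where "P x"
proof -
  obtain S where S: "closure S = UNIV" "\<forall>x\<in>S. P x"
    using assms unfolding generic_def by blast
  then have "S \<noteq> {}" by auto
  then show ?thesis using S that by blast
qed

lemma generic_homeo:
  fixes \<phi> :: "'a::topological_space \<Rightarrow> 'b::topological_space"
  assumes "generic P" "continuous_on UNIV \<phi>" "continuous_on UNIV \<psi>"
    "\<And>x. \<psi> (\<phi> x) = x" "\<And>y. \<phi> (\<psi> y) = y"
  shows "generic (\<lambda>x. P (\<phi> x))"
proof -
  obtain S where S: "open S" "closure S = UNIV" "\<forall>x\<in>S. P x"
    using assms(1) unfolding generic_def by blast
  have im: "\<phi> -` S = \<psi> ` S" using assms(4,5) by (auto simp: image_iff) metis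
  have "UNIV = \<psi> ` closure S" using S(2) assms(4) by (metis surjI)
  also have "\<dots> \<subseteq> closure (\<psi> ` S)"
    by (intro image_closure_subset[OF continuous_on_subset[OF assms(3)]]) (auto simp: closure_subset)
  finally have "closure (\<phi> -` S) = UNIV" unfolding im by blast
  moreover have "open (\<phi> -` S)" using S(1) assms(2) by (simp add: open_vimage)
  ultimately show ?thesis using S(3) unfolding generic_def by (intro exI[of _ "\<phi> -` S"]) auto
qed

section \<open>Genericity under dynamical shifts and on product spaces\<close>

lemma shift_eq_axis: "shift \<gamma> l j = l + axis j \<gamma>"
  by (auto simp: shift_def axis_def vec_eq_iff)

lemma shift_nth: "shift \<gamma> l p $ b = (if b = p then l $ b + \<gamma> else l $ b)"
  by (simp add: shift_def)

lemma generic_shift: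
  assumes "generic P"
  shows "generic (\<lambda>l. P (shift \<gamma> l j))"
  by (rule generic_homeo[OF assms, of _ "\<lambda>l. shift (-\<gamma>) l j"])
    (auto simp: shift_eq_axis axis_def vec_eq_iff intro!: continuous_intros)

text \<open>The necessary conditions first constrain \<open>k1\<close> at the shifted argument; this
  carries the conclusion back to \<lambda> itself.\<close>

lemma generic_unshift:
  assumes "generic (\<lambda>l. P (shift \<gamma> l j))"
  shows "generic P"
  using generic_shift[OF assms, of "-\<gamma>" j]
proof (rule generic_mono)
  fix l
  have "shift \<gamma> (shift (-\<gamma>) l j) j = l" by (simp add: shift_def vec_eq_iff)
  then show "P (shift \<gamma> (shift (-\<gamma>) l j) j) \<Longrightarrow> P l" by simp
qed

lemma generic_snd:
  fixes P :: "'b::topological_space \<Rightarrow> bool"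
  assumes "generic P"
  shows "generic (\<lambda>(x::'a::topological_space, y). P y)"
proof -
  obtain S where "open S" "closure S = UNIV" "\<forall>x\<in>S. P x"
    using assms unfolding generic_def by blast
  then show ?thesis unfolding generic_def
    by (intro exI[of _ "UNIV \<times> S"]) (auto simp: closure_Times open_Times)
qed

text \<open>The graph of a continuous map into a Hausdorff space is closed, and its complement is
  dense because points of a perfect space are not isolated.\<close>

lemma generic_neq_fst:
  fixes g :: "'b::topological_space \<Rightarrow> 'a::{perfect_space,t2_space}"
  assumes "continuous_on UNIV g"
  shows "generic (\<lambda>(x, y). x \<noteq> g y)"
proof -
  let ?S = "{z. fst z \<noteq> g (snd z)}"
  have op: "open ?S"
  proof (rule open_Collect_neq)
    show "continuous_on UNIV (\<lambda>z. g (snd z))"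
      by (rule continuous_on_compose2[OF assms]) (auto intro: continuous_intros)
  qed (auto intro: continuous_intros)
  have "(x, y) \<in> closure ?S" for x y
    unfolding closure_iff_nhds_not_empty
  proof (intro allI impI)
    fix A V assume A: "V \<subseteq> A" "open V" "(x, y) \<in> V"
    obtain X Y where XY: "open X" "open Y" "x \<in> X" "y \<in> Y" "X \<times> Y \<subseteq> V"
      by (rule open_prod_elim[OF A(2,3)]) auto
    then have "X \<noteq> {g y}" using not_open_singleton[of "g y"] by blast
    then obtain x' where "x' \<in> X" "x' \<noteq> g y" using XY(3) by blast
    then have "(x', y) \<in> ?S \<inter> A" using XY A(1) by auto
    then show "?S \<inter> A \<noteq> {}" by blast
  qed
  then show ?thesis using op unfolding generic_def
    by (intro exI[of _ ?S]) auto
qed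

section \<open>Meromorphic functions of several variables\<close>

lemma holomorphic_Cn_on_subset: "holomorphic_Cn_on g U \<Longrightarrow> V \<subseteq> U \<Longrightarrow> holomorphic_Cn_on g V"
  unfolding holomorphic_Cn_on_def by blast

lemma holomorphic_Cn_on_imp_continuous_on: "holomorphic_Cn_on g U \<Longrightarrow> continuous_on U g"
  unfolding holomorphic_Cn_on_def
  by (meson continuous_at_imp_continuous_on has_derivative_continuous)

lemma holomorphic_Cn_on_const: "holomorphic_Cn_on (\<lambda>l. c) U"
  unfolding holomorphic_Cn_on_def by (auto intro!: exI[of _ "\<lambda>l. 0"])

lemma holomorphic_Cn_on_component: "holomorphic_Cn_on (\<lambda>l. l $ i) U"
  unfolding holomorphic_Cn_on_def
  by (auto intro!: exI[of _ "\<lambda>l. l $ i"] bounded_linear_imp_has_derivative bounded_linear_vec_nth)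

lemma holomorphic_Cn_on_add:
  assumes "holomorphic_Cn_on g U" "holomorphic_Cn_on h U"
  shows "holomorphic_Cn_on (\<lambda>l. g l + h l) U"
  unfolding holomorphic_Cn_on_def
proof
  fix x assume "x \<in> U"
  then obtain g' h' where "(g has_derivative g') (at x)" "\<forall>c v. g' (c *s v) = c * g' v"
    "(h has_derivative h') (at x)" "\<forall>c v. h' (c *s v) = c * h' v"
    using assms unfolding holomorphic_Cn_on_def by blast
  then show "\<exists>k'. ((\<lambda>l. g l + h l) has_derivative k') (at x) \<and> (\<forall>c v. k' (c *s v) = c * k' v)"
    by (intro exI[of _ "\<lambda>v. g' v + h' v"]) (auto intro: has_derivative_add simp: algebra_simps)
qed

lemma holomorphic_Cn_on_mult:
  assumes "holomorphic_Cn_on g U" "holomorphic_Cn_on h U"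
  shows "holomorphic_Cn_on (\<lambda>l. g l * h l) U"
  unfolding holomorphic_Cn_on_def
proof
  fix x assume "x \<in> U"
  then obtain g' h' where "(g has_derivative g') (at x)" "\<forall>c v. g' (c *s v) = c * g' v"
    "(h has_derivative h') (at x)" "\<forall>c v. h' (c *s v) = c * h' v"
    using assms unfolding holomorphic_Cn_on_def by blast
  then show "\<exists>k'. ((\<lambda>l. g l * h l) has_derivative k') (at x) \<and> (\<forall>c v. k' (c *s v) = c * k' v)"
    by (intro exI[of _ "\<lambda>v. g x * h' v + g' v * h x"])
      (auto intro!: has_derivative_mult simp: algebra_simps)
qed

lemma meromorphic_Cn_holomorphic:
  assumes "holomorphic_Cn_on g UNIV"
  shows "meromorphic_Cn g"
  unfolding meromorphic_Cn_def
  by (intro allI exI[of _ UNIV] exI[of _ g] exI[of _ "\<lambda>l. 1"])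
    (use assms in \<open>auto simp: holomorphic_Cn_on_const\<close>)

lemma meromorphic_CnE:
  assumes "meromorphic_Cn f"
  obtains U g h where "open U" "p \<in> U" "holomorphic_Cn_on g U" "holomorphic_Cn_on h U"
    "U \<subseteq> closure {x\<in>U. h x \<noteq> 0}" "\<And>x. x \<in> U \<Longrightarrow> h x \<noteq> 0 \<Longrightarrow> f x = g x / h x"
  using assms unfolding meromorphic_Cn_def by meson

lemma open_nonzero:
  assumes "open U" "holomorphic_Cn_on h U"
  shows "open {x\<in>U. h x \<noteq> 0}"
proof -
  have "open (U \<inter> h -` (-{0}))"
    using assms by (intro continuous_open_preimage holomorphic_Cn_on_imp_continuous_on) auto
  then show ?thesis by (simp add: vimage_def Int_def)
qed

text \<open>Ensures that the product of two admissible denominators is again admissible: two open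
  dense sets meet in a dense set, here relative to U and V.\<close>

lemma dense_nonzero_mult:
  assumes "open U" "open V" "holomorphic_Cn_on g U" "holomorphic_Cn_on h V"
    and g: "U \<subseteq> closure {x\<in>U. g x \<noteq> 0}" and h: "V \<subseteq> closure {x\<in>V. h x \<noteq> 0}"
  shows "U \<inter> V \<subseteq> closure {x\<in>U \<inter> V. g x * h x \<noteq> 0}"
proof -
  let ?G = "{x\<in>U. g x \<noteq> 0}" and ?H = "{x\<in>V. h x \<noteq> 0}"
  have "U \<inter> V \<subseteq> V \<inter> closure ?G" using g by blast
  also have "\<dots> \<subseteq> closure (V \<inter> ?G)" by (rule open_Int_closure_subset[OF assms(2)])
  also have "\<dots> \<subseteq> closure (closure (?G \<inter> ?H))"
  proof (rule closure_mono)
    have "V \<inter> ?G \<subseteq> ?G \<inter> closure ?H" using h by blast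
    also have "\<dots> \<subseteq> closure (?G \<inter> ?H)"
      by (rule open_Int_closure_subset[OF open_nonzero[OF assms(1,3)]])
    finally show "V \<inter> ?G \<subseteq> closure (?G \<inter> ?H)" .
  qed
  also have "?G \<inter> ?H = {x\<in>U \<inter> V. g x * h x \<noteq> 0}" by auto
  finally show ?thesis by simp
qed

lemma meromorphic_Cn_add:
  assumes "meromorphic_Cn F" "meromorphic_Cn G"
  shows "meromorphic_Cn (\<lambda>l. F l + G l)"
  unfolding meromorphic_Cn_def
proof
  fix p
  obtain U g h where U: "open U" "p \<in> U" "holomorphic_Cn_on g U" "holomorphic_Cn_on h U"
    "U \<subseteq> closure {x\<in>U. h x \<noteq> 0}" "\<And>x. x \<in> U \<Longrightarrow> h x \<noteq> 0 \<Longrightarrow> F x = g x / h x"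
    using meromorphic_CnE[OF assms(1)] by blast
  obtain V g' h' where V: "open V" "p \<in> V" "holomorphic_Cn_on g' V" "holomorphic_Cn_on h' V"
    "V \<subseteq> closure {x\<in>V. h' x \<noteq> 0}" "\<And>x. x \<in> V \<Longrightarrow> h' x \<noteq> 0 \<Longrightarrow> G x = g' x / h' x"
    using meromorphic_CnE[OF assms(2)] by blast
  have hol: "holomorphic_Cn_on g (U \<inter> V)" "holomorphic_Cn_on h (U \<inter> V)"
    "holomorphic_Cn_on g' (U \<inter> V)" "holomorphic_Cn_on h' (U \<inter> V)"
    using U(3,4) V(3,4) by (auto elim: holomorphic_Cn_on_subset)
  have dense: "U \<inter> V \<subseteq> closure {x\<in>U \<inter> V. h x * h' x \<noteq> 0}"
    using dense_nonzero_mult U V by blast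
  show "\<exists>U g h. open U \<and> p \<in> U \<and> holomorphic_Cn_on g U \<and> holomorphic_Cn_on h U \<and>
        U \<subseteq> closure {x\<in>U. h x \<noteq> 0} \<and> (\<forall>x\<in>U. h x \<noteq> 0 \<longrightarrow> F x + G x = g x / h x)"
  proof (intro exI conjI)
    show "open (U \<inter> V)" "p \<in> U \<inter> V" using U V by auto
    show "holomorphic_Cn_on (\<lambda>l. g l * h' l + g' l * h l) (U \<inter> V)"
      by (intro holomorphic_Cn_on_mult holomorphic_Cn_on_add hol)
    show "holomorphic_Cn_on (\<lambda>l. h l * h' l) (U \<inter> V)"
      by (intro holomorphic_Cn_on_mult hol)
    show "\<forall>x\<in>U \<inter> V. h x * h' x \<noteq> 0 \<longrightarrow> F x + G x = (g x * h' x + g' x * h x) / (h x * h' x)"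
      using U(6) V(6) by (simp add: add_frac_eq)
  qed (rule dense)
qed

lemma meromorphic_Cn_mult:
  assumes "meromorphic_Cn F" "meromorphic_Cn G"
  shows "meromorphic_Cn (\<lambda>l. F l * G l)"
  unfolding meromorphic_Cn_def
proof
  fix p
  obtain U g h where U: "open U" "p \<in> U" "holomorphic_Cn_on g U" "holomorphic_Cn_on h U"
    "U \<subseteq> closure {x\<in>U. h x \<noteq> 0}" "\<And>x. x \<in> U \<Longrightarrow> h x \<noteq> 0 \<Longrightarrow> F x = g x / h x"
    using meromorphic_CnE[OF assms(1)] by blast
  obtain V g' h' where V: "open V" "p \<in> V" "holomorphic_Cn_on g' V" "holomorphic_Cn_on h' V"
    "V \<subseteq> closure {x\<in>V. h' x \<noteq> 0}" "\<And>x. x \<in> V \<Longrightarrow> h' x \<noteq> 0 \<Longrightarrow> G x = g' x / h' x"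
    using meromorphic_CnE[OF assms(2)] by blast
  have hol: "holomorphic_Cn_on g (U \<inter> V)" "holomorphic_Cn_on h (U \<inter> V)"
    "holomorphic_Cn_on g' (U \<inter> V)" "holomorphic_Cn_on h' (U \<inter> V)"
    using U(3,4) V(3,4) by (auto elim: holomorphic_Cn_on_subset)
  have dense: "U \<inter> V \<subseteq> closure {x\<in>U \<inter> V. h x * h' x \<noteq> 0}"
    using dense_nonzero_mult U V by blast
  show "\<exists>U g h. open U \<and> p \<in> U \<and> holomorphic_Cn_on g U \<and> holomorphic_Cn_on h U \<and>
        U \<subseteq> closure {x\<in>U. h x \<noteq> 0} \<and> (\<forall>x\<in>U. h x \<noteq> 0 \<longrightarrow> F x * G x = g x / h x)"
  proof (intro exI conjI)
    show "open (U \<inter> V)" "p \<in> U \<inter> V" using U V by auto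
    show "holomorphic_Cn_on (\<lambda>l. g l * g' l) (U \<inter> V)"
      by (intro holomorphic_Cn_on_mult hol)
    show "holomorphic_Cn_on (\<lambda>l. h l * h' l) (U \<inter> V)"
      by (intro holomorphic_Cn_on_mult hol)
    show "\<forall>x\<in>U \<inter> V. h x * h' x \<noteq> 0 \<longrightarrow> F x * G x = (g x * g' x) / (h x * h' x)"
      using U(6) V(6) by simp
  qed (rule dense)
qed

lemma meromorphic_Cn_const: "meromorphic_Cn (\<lambda>l. c)"
  by (intro meromorphic_Cn_holomorphic holomorphic_Cn_on_const)

lemma meromorphic_Cn_component: "meromorphic_Cn (\<lambda>l. l $ i)"
  by (intro meromorphic_Cn_holomorphic holomorphic_Cn_on_component)

lemma meromorphic_Cn_uminus: "meromorphic_Cn F \<Longrightarrow> meromorphic_Cn (\<lambda>l. - F l)"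
  using meromorphic_Cn_mult[OF meromorphic_Cn_const[of "-1"]] by fastforce

lemma meromorphic_Cn_diff:
  "meromorphic_Cn F \<Longrightarrow> meromorphic_Cn G \<Longrightarrow> meromorphic_Cn (\<lambda>l. F l - G l)"
  using meromorphic_Cn_add[of F, OF _ meromorphic_Cn_uminus] by fastforce

lemma meromorphic_Cn_sum:
  assumes "\<And>a. a \<in> A \<Longrightarrow> meromorphic_Cn (F a)"
  shows "meromorphic_Cn (\<lambda>l. \<Sum>a\<in>A. F a l)"
  using assms
  by (induction A rule: infinite_finite_induct) (auto intro: meromorphic_Cn_add meromorphic_Cn_const)

lemma meromorphic_Cn_prod:
  assumes "\<And>a. a \<in> A \<Longrightarrow> meromorphic_Cn (F a)"
  shows "meromorphic_Cn (\<lambda>l. \<Prod>a\<in>A. F a l)"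
  using assms
  by (induction A rule: infinite_finite_induct) (auto intro: meromorphic_Cn_mult meromorphic_Cn_const)

lemma meromorphic_Cn_Lam: "meromorphic_Cn (\<lambda>l. Lam l i)"
  unfolding Lam_def by (intro meromorphic_Cn_diff meromorphic_Cn_sum meromorphic_Cn_component)

lemma meromorphic_Cn_Lam2: "meromorphic_Cn (\<lambda>l. Lam2 l i j)"
  unfolding Lam2_def
  by (intro meromorphic_Cn_diff meromorphic_Cn_add meromorphic_Cn_sum meromorphic_Cn_component)

text \<open>Restriction to complex lines through a point near which \<open>g\<close> vanishes reduces this to one variable.\<close>

lemma holomorphic_Cn_on_identity:
  fixes g :: "complex^'n::finite \<Rightarrow> complex"
  assumes "holomorphic_Cn_on g B" "open B" "convex B" "open W" "q \<in> W" "W \<subseteq> B"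
    "\<And>y. y \<in> W \<Longrightarrow> g y = 0" "x \<in> B"
  shows "g x = 0"
proof -
  \<comment> \<open>The complex line with value q at 0 and x at 1. The preimage of the convex set B
    is convex, hence connected, so analytic continuation reaches 1 from a neighbourhood of
    0.\<close>
  define \<phi> where "\<phi> t = q + t *s (x - q)" for t :: complex
  have lin: "bounded_linear (\<lambda>t::complex. t *s (x - q))"
    by (intro linear_conv_bounded_linear[THEN iffD1] linearI)
      (auto simp: vec_eq_iff algebra_simps)
  have cont: "continuous_on UNIV \<phi>" unfolding \<phi>_def
    by (intro continuous_intros linear_continuous_on[OF lin])
  have der: "(\<phi> has_derivative (\<lambda>t. t *s (x - q))) (at t)" for t
    unfolding \<phi>_def using has_derivative_add[OF has_derivative_const bounded_linear_imp_has_derivative[OF lin]]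
    by simp
  define D where "D = \<phi> -` B"
  have "convex D"
  proof (rule convexI)
    fix s t :: complex and a b :: real
    assume *: "s \<in> D" "t \<in> D" "0 \<le> a" "0 \<le> b" "a + b = 1"
    have q: "a *\<^sub>R q + b *\<^sub>R q = q" using *(5) by (metis scaleR_add_left scaleR_one)
    have "\<phi> (a *\<^sub>R s + b *\<^sub>R t) = a *\<^sub>R \<phi> s + b *\<^sub>R \<phi> t"
      unfolding \<phi>_def by (subst q[symmetric])
        (auto simp: vec_eq_iff algebra_simps scaleR_conv_of_real[where 'a=complex])
    then show "a *\<^sub>R s + b *\<^sub>R t \<in> D"
      using * convexD[OF assms(3)] unfolding D_def by simp
  qed
  moreover have "open D" unfolding D_def using assms(2) cont by (simp add: open_vimage)
  moreover have "(g \<circ> \<phi>) holomorphic_on D"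
    unfolding holomorphic_on_def field_differentiable_def
  proof
    fix t assume "t \<in> D"
    then obtain g' where g': "(g has_derivative g') (at (\<phi> t))" "\<forall>c v. g' (c *s v) = c * g' v"
      using assms(1) unfolding holomorphic_Cn_on_def D_def by auto
    have "((g \<circ> \<phi>) has_derivative (g' \<circ> (\<lambda>t. t *s (x - q)))) (at t)"
      by (rule diff_chain_at[OF der g'(1)])
    moreover have "g' \<circ> (\<lambda>t. t *s (x - q)) = (*) (g' (x - q))"
      by (intro ext) (metis comp_apply mult.commute g'(2))
    ultimately show "\<exists>f'. ((g \<circ> \<phi>) has_field_derivative f') (at t within D)"
      unfolding has_field_derivative_def using has_derivative_at_withinI by metis
  qed
  moreover have "open (\<phi> -` W)" using assms(4) cont by (simp add: open_vimage)
  moreover have "0 \<in> \<phi> -` W" using assms(5) by (simp add: \<phi>_def)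
  moreover have "\<phi> -` W \<subseteq> D" using assms(6) D_def by auto
  moreover have "1 \<in> D" using assms(8) by (simp add: D_def \<phi>_def)
  moreover have "\<And>z. z \<in> \<phi> -` W \<Longrightarrow> (g \<circ> \<phi>) z = 0" using assms(7) by auto
  ultimately have "(g \<circ> \<phi>) 1 = 0"
    by (intro analytic_continuation_open[of "\<phi> -` W" D "g \<circ> \<phi>" "\<lambda>_. 0" 1])
      (auto simp: convex_connected)
  then show ?thesis by (simp add: \<phi>_def)
qed

text \<open>
  The interiors of the closures of \<open>Z\<close> and \<open>N\<close> below are open and disjoint, and they cover the
  connected space by the local identity theorem.
\<close>

lemma meromorphic_Cn_dichotomy:
  fixes F :: "complex^'n::finite \<Rightarrow> complex"
  assumes "meromorphic_Cn F"
  shows "generic (\<lambda>l. F l = 0) \<or> generic (\<lambda>l. F l \<noteq> 0)"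
proof -
  define Z N where "Z = interior {l. F l = 0}" and "N = interior {l. F l \<noteq> 0}"
  have op: "open Z" "open N" unfolding Z_def N_def by auto
  have ZN: "Z \<inter> N = {}" unfolding Z_def N_def using interior_subset by blast
  have cover: "p \<in> interior (closure Z) \<or> p \<in> interior (closure N)" for p
  proof -
    obtain U g h where U: "open U" "p \<in> U" "holomorphic_Cn_on g U" "holomorphic_Cn_on h U"
      "U \<subseteq> closure {x\<in>U. h x \<noteq> 0}" "\<And>x. x \<in> U \<Longrightarrow> h x \<noteq> 0 \<Longrightarrow> F x = g x / h x"
      using meromorphic_CnE[OF assms] by blast
    \<comment> \<open>The local identity theorem needs a convex domain, hence the passage from U to
      a ball.\<close>
    obtain r where r: "r > 0" "ball p r \<subseteq> U" using U(1,2) openE by blast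
    define B where "B = ball p r"
    have B: "open B" "convex B" "p \<in> B" "B \<subseteq> U" using r unfolding B_def by auto
    have hol: "holomorphic_Cn_on g B" "holomorphic_Cn_on h B"
      using U(3,4) B(4) holomorphic_Cn_on_subset by blast+
    have hB: "B \<subseteq> closure {x\<in>B. h x \<noteq> 0}"
    proof -
      have "B \<subseteq> B \<inter> closure {x\<in>U. h x \<noteq> 0}" using B(4) U(5) by blast
      also have "\<dots> \<subseteq> closure (B \<inter> {x\<in>U. h x \<noteq> 0})" by (rule open_Int_closure_subset[OF B(1)])
      also have "B \<inter> {x\<in>U. h x \<noteq> 0} = {x\<in>B. h x \<noteq> 0}" using B(4) by blast
      finally show ?thesis .
    qed
    show ?thesis
    proof (cases "\<forall>x\<in>B. g x = 0")
      case True
      have "{x\<in>B. h x \<noteq> 0} \<subseteq> Z" unfolding Z_def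
        using True U(6) B(4) by (intro interior_maximal open_nonzero[OF B(1) hol(2)]) auto
      then have "B \<subseteq> closure Z" using hB closure_mono by blast
      then show ?thesis using B interior_maximal by blast
    next
      case False
      \<comment> \<open>By the identity theorem a numerator that is nonzero somewhere on the ball
        vanishes on no open part of it.\<close>
      have gB: "B \<subseteq> closure {x\<in>B. g x \<noteq> 0}"
      proof
        fix y assume "y \<in> B"
        show "y \<in> closure {x\<in>B. g x \<noteq> 0}"
        proof (rule ccontr)
          assume y: "y \<notin> closure {x\<in>B. g x \<noteq> 0}"
          let ?W = "B - closure {x\<in>B. g x \<noteq> 0}"
          have "open ?W" "y \<in> ?W" "?W \<subseteq> B" using B(1) \<open>y \<in> B\<close> y by (auto intro: open_Diff)
          moreover have "g z = 0" if "z \<in> ?W" for z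
            using that closure_subset[of "{x\<in>B. g x \<noteq> 0}"] by blast
          ultimately have "\<forall>x\<in>B. g x = 0"
            using holomorphic_Cn_on_identity[OF hol(1) B(1,2)] by blast
          then show False using False by blast
        qed
      qed
      have "B \<subseteq> closure {x\<in>B. g x * h x \<noteq> 0}"
        using dense_nonzero_mult[OF B(1) B(1) hol gB hB] by simp
      moreover have "{x\<in>B. g x * h x \<noteq> 0} \<subseteq> N" unfolding N_def
        using U(6) B(4)
        by (intro interior_maximal open_nonzero[OF B(1)] holomorphic_Cn_on_mult hol) auto
      ultimately have "B \<subseteq> closure N" using closure_mono by blast
      then show ?thesis using B interior_maximal by blast
    qed
  qed
  \<comment> \<open>An open set inside both closures would meet the open set Z, and this open
    intersection would in turn meet N.\<close>
  have disj: "interior (closure Z) \<inter> interior (closure N) = {}"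
  proof (rule ccontr)
    let ?W = "interior (closure Z) \<inter> interior (closure N)"
    assume "?W \<noteq> {}"
    moreover have oW: "open ?W" by auto
    moreover have "?W \<subseteq> closure Z" "?W \<subseteq> closure N" using interior_subset by blast+
    ultimately have "?W \<inter> Z \<noteq> {}" using open_Int_closure_eq_empty[of ?W Z] by blast
    moreover have "open (?W \<inter> Z)" using oW op by blast
    moreover have "?W \<inter> Z \<subseteq> closure N" using \<open>?W \<subseteq> closure N\<close> by blast
    ultimately have "?W \<inter> Z \<inter> N \<noteq> {}" using open_Int_closure_eq_empty[of "?W \<inter> Z" N] by blast
    then show False using ZN by blast
  qed
  have "interior (closure Z) = {} \<or> interior (closure N) = {}"
    using connected_UNIV[where 'a = "complex^'n"] disj cover unfolding connected_def by blast
  then have "interior (closure Z) = UNIV \<or> interior (closure N) = UNIV" using cover by blast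
  then have "closure Z = UNIV \<or> closure N = UNIV" using interior_subset by blast
  moreover have "\<forall>l\<in>Z. F l = 0" "\<forall>l\<in>N. F l \<noteq> 0" unfolding Z_def N_def using interior_subset by blast+
  ultimately show ?thesis unfolding generic_def using op by blast
qed

lemma generic_neq_component:
  fixes c :: complex
  assumes "i \<noteq> j"
  shows "generic (\<lambda>l::complex^'n::finite. l $ i - l $ j \<noteq> c)"
proof -
  have "meromorphic_Cn (\<lambda>l::complex^'n. l $ i - l $ j - c)"
    by (intro meromorphic_Cn_diff meromorphic_Cn_component meromorphic_Cn_const)
  then consider "generic (\<lambda>l::complex^'n. l $ i - l $ j - c = 0)"
    | "generic (\<lambda>l::complex^'n. l $ i - l $ j - c \<noteq> 0)"
    using meromorphic_Cn_dichotomy by blast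
  then show ?thesis
  proof cases
    case 1
    then obtain S where S: "closure S = UNIV" "S \<subseteq> {l::complex^'n. l $ i - l $ j - c = 0}"
      unfolding generic_def by blast
    \<comment> \<open>A closed dense set is the whole space, but at \<open>axis i (c + 1)\<close>
      the difference of coordinates is c + 1, not c.\<close>
    have "closed {l::complex^'n. l $ i - l $ j - c = 0}"
      by (intro closed_Collect_eq continuous_intros)
    then have "l $ i - l $ j - c = 0" for l :: "complex^'n"
      using closure_minimal[OF S(2)] S(1) by blast
    from this[of "axis i (c + 1)"] show ?thesis using assms by (simp add: axis_def)
  qed simp
qed

lemma meromorphic_Cn_inverse_diff:
  assumes "i \<noteq> j"
  shows "meromorphic_Cn (\<lambda>l::complex^'n::finite. c / (l $ i - l $ j))"
proof -
  have h: "holomorphic_Cn_on (\<lambda>l::complex^'n. l $ i - l $ j) UNIV"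
    using holomorphic_Cn_on_add[OF holomorphic_Cn_on_component
        holomorphic_Cn_on_mult[OF holomorphic_Cn_on_const[of "-1"] holomorphic_Cn_on_component]]
    by simp
  obtain S :: "(complex^'n) set" where "closure S = UNIV" "\<forall>l\<in>S. l $ i - l $ j \<noteq> 0"
    using generic_neq_component[OF assms, of 0] unfolding generic_def by blast
  then have "closure {l::complex^'n. l $ i - l $ j \<noteq> 0} = UNIV"
    using closure_mono[of S "{l. l $ i - l $ j \<noteq> 0}"] by auto
  then show ?thesis unfolding meromorphic_Cn_def using h
    by (intro allI exI[of _ UNIV] exI[of _ "\<lambda>l. c"] exI[of _ "\<lambda>l. l $ i - l $ j"])
      (auto simp: holomorphic_Cn_on_const)
qed

section \<open>The reflection equation in components\<close>

lemma sum_UNIV_single: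
  fixes F :: "'a::finite \<Rightarrow> 'b::comm_monoid_add"
  assumes "\<And>i. i \<noteq> i0 \<Longrightarrow> F i = 0"
  shows "(\<Sum>i\<in>UNIV. F i) = F i0"
  using assms by (subst sum.remove[of _ i0]) auto

text \<open>In a fixed row of \<open>A_inf\<close>, \<open>B_inf\<close> or \<open>D_inf\<close> the
  matrix units leave at most one pair (i, j), and that pair is missing from the sum when i =
  j.\<close>

lemma sum_off_diagonal_single:
  fixes F :: "'a::finite \<Rightarrow> 'a \<Rightarrow> 'b::comm_monoid_add"
  assumes "\<And>i j. i \<noteq> i0 \<or> j \<noteq> j0 \<Longrightarrow> F i j = 0"
  shows "(\<Sum>i\<in>UNIV. \<Sum>j\<in>UNIV - {i}. F i j) = (if i0 = j0 then 0 else F i0 j0)"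
proof -
  have "(\<Sum>i\<in>UNIV. \<Sum>j\<in>UNIV - {i}. F i j) = (\<Sum>j\<in>UNIV - {i0}. F i0 j)"
    using assms by (intro sum_UNIV_single) auto
  also have "\<dots> = (if i0 = j0 then 0 else F i0 j0)"
  proof (cases "i0 = j0")
    case True
    then show ?thesis using assms by auto
  next
    case False
    then show ?thesis using assms by (subst sum.remove[of _ j0]) auto
  qed
  finally show ?thesis .
qed

lemma sum_delta_mult:
  fixes F :: "'a::finite \<Rightarrow> complex"
  shows "(\<Sum>i\<in>UNIV. (if i = x then 1 else 0) * F i) = F x"
    and "(\<Sum>i\<in>UNIV. F i * (if i = x then 1 else 0)) = F x"
  by (subst sum_UNIV_single[of x], auto)+

section \<open>Entries of the structure matrices\<close>

lemma E_nth: "E i j $ a $ b = (if a = i \<and> b = j then 1 else 0)"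
  by (simp add: E_def)

lemma kron_nth: "(X \<otimes>\<^sub>K Y) $ (a, b) $ (c, d) = X $ a $ c * Y $ b $ d"
  by (simp add: kron_def)

lemma mscale_nth: "(c *\<^sub>c M) $ a $ b = c * M $ a $ b"
  by (simp add: mscale_def)

lemma flip_nth: "flip M $ (a, b) $ (c, d) = M $ (b, a) $ (d, c)"
  by (simp add: flip_def)

lemma mat_1_nth: "(mat 1 :: complex^'m^'m) $ a $ b = (if a = b then 1 else 0)"
  by (simp add: mat_def)

lemma kron_mat_1_nth: "((mat 1 :: complex^'n::finite^'n) \<otimes>\<^sub>K mat 1) $ r $ s = (if r = s then 1 else 0)"
  by (cases r, cases s) (simp add: kron_nth mat_1_nth)

lemma d12_nth: "d12 $ (a, b) $ s = (if s = (b, a) then 1 else 0)"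
proof (cases s)
  case (Pair c d)
  have "d12 $ (a, b) $ (c, d) = (\<Sum>i\<in>UNIV. \<Sum>j\<in>UNIV. E i j $ a $ c * E j i $ b $ d)"
    by (simp add: d12_def kron_nth)
  also have "\<dots> = (\<Sum>j\<in>UNIV. E a j $ a $ c * E j a $ b $ d)"
    by (rule sum_UNIV_single) (simp add: E_nth)
  also have "\<dots> = E a b $ a $ c * E b a $ b $ d"
    by (rule sum_UNIV_single) (simp add: E_nth)
  finally show ?thesis by (auto simp: Pair E_nth)
qed

lemma b12_nth: "b12 $ (a, b) $ s = (if s = (a, a) then 1 else 0)"
proof (cases s)
  case (Pair c d)
  have "b12 $ (a, b) $ (c, d) = (\<Sum>i\<in>UNIV. \<Sum>j\<in>UNIV. E i i $ a $ c * E j i $ b $ d)"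
    by (simp add: b12_def kron_nth)
  also have "\<dots> = (\<Sum>j\<in>UNIV. E a a $ a $ c * E j a $ b $ d)"
    by (rule sum_UNIV_single) (simp add: E_nth)
  also have "\<dots> = E a a $ a $ c * E b a $ b $ d"
    by (rule sum_UNIV_single) (simp add: E_nth)
  finally show ?thesis by (auto simp: Pair E_nth)
qed

lemma flip_b12_nth: "flip b12 $ (a, b) $ s = (if s = (b, b) then 1 else 0)"
  by (cases s) (simp add: flip_nth b12_nth conj_commute)

lemma A_inf_nth:
  "A_inf \<gamma> l $ (a, b) $ s = (if s = (a, b) then 1 else 0) + (if a = b then 0 else \<gamma> / (l $ a - l $ b)) *
     ((if s = (a, b) then 1 else 0) - (if s = (a, a) then 1 else 0)
      - (if s = (b, b) then 1 else 0) + (if s = (b, a) then 1 else 0))"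
proof (cases s)
  case (Pair c d)
  define F where "F i j = \<gamma> / (l $ i - l $ j) *
    ((E i i $ a $ c - E i j $ a $ c) * (E j j $ b $ d - E j i $ b $ d))" for i j
  have "A_inf \<gamma> l $ (a, b) $ s = (if s = (a, b) then 1 else 0) + (\<Sum>i\<in>UNIV. \<Sum>j\<in>UNIV - {i}. F i j)"
    unfolding A_inf_def F_def by (simp add: Pair kron_mat_1_nth) (simp add: kron_nth mscale_nth)
  also have "(\<Sum>i\<in>UNIV. \<Sum>j\<in>UNIV - {i}. F i j) = (if a = b then 0 else F a b)"
    by (rule sum_off_diagonal_single) (auto simp: F_def E_nth)
  finally show ?thesis by (auto simp: F_def E_nth Pair)
qed

lemma B_inf_nth:
  "B_inf \<gamma> l $ (a, b) $ s = (if s = (a, b) then 1 else 0) + (if a = b then 0 else \<gamma> / (l $ b - l $ a - \<gamma>)) *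
     ((if s = (a, b) then 1 else 0) - (if s = (a, a) then 1 else 0))"
proof (cases s)
  case (Pair c d)
  define F where "F i j = \<gamma> / (l $ i - l $ j - \<gamma>) *
    (E j j $ a $ c * (E i i $ b $ d - E i j $ b $ d))" for i j
  have "B_inf \<gamma> l $ (a, b) $ s = (if s = (a, b) then 1 else 0) + (\<Sum>i\<in>UNIV. \<Sum>j\<in>UNIV - {i}. F i j)"
    unfolding B_inf_def F_def by (simp add: Pair kron_mat_1_nth) (simp add: kron_nth mscale_nth)
  also have "(\<Sum>i\<in>UNIV. \<Sum>j\<in>UNIV - {i}. F i j) = (if b = a then 0 else F b a)"
    by (rule sum_off_diagonal_single) (auto simp: F_def E_nth)
  finally show ?thesis by (auto simp: F_def E_nth Pair)
qed

text \<open>Organized by columns, since D multiplies from the right. The permuting term sits in row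
  (q, p), where the coefficient is \<gamma> divided by \<open>l $ q - l $ p\<close>; this gives it
  the same sign as the diagonal term.\<close>

lemma D_inf_nth:
  "D_inf \<gamma> l $ s $ (p, q) = (if s = (p, q) then 1 else 0) - (if p = q then 0 else \<gamma> / (l $ p - l $ q)) *
     ((if s = (p, q) then 1 else 0) + (if s = (q, p) then 1 else 0))"
proof (cases s)
  case (Pair c d)
  define F where "F i j = \<gamma> / (l $ i - l $ j) *
    (E i j $ c $ p * E j i $ d $ q - E i i $ c $ p * E j j $ d $ q)" for i j
  have "D_inf \<gamma> l $ s $ (p, q) = (if s = (p, q) then 1 else 0) + (\<Sum>i\<in>UNIV. \<Sum>j\<in>UNIV - {i}. F i j)"
    unfolding D_inf_def F_def by (simp add: Pair kron_mat_1_nth) (simp add: kron_nth mscale_nth)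
  also have "(\<Sum>i\<in>UNIV. \<Sum>j\<in>UNIV - {i}. F i j) = (if c = d then 0 else F c d)"
    by (rule sum_off_diagonal_single) (auto simp: F_def E_nth)
  finally show ?thesis
    using minus_divide_right[of \<gamma> "l $ p - l $ q"] by (auto simp: F_def E_nth Pair)
qed

section \<open>Products with the structure matrices\<close>

lemma A12_mult_nth:
  "(A12 \<gamma> u v l ** M) $ (a, b) $ r = M $ (a, b) $ r + (if a = b then 0 else \<gamma> / (l $ a - l $ b)) *
       (M $ (a, b) $ r - M $ (a, a) $ r - M $ (b, b) $ r + M $ (b, a) $ r)
     + \<gamma> / (u - v) * M $ (b, a) $ r + \<gamma> / v * M $ (a, a) $ r - \<gamma> / (u + \<gamma>) * M $ (b, b) $ r"
  unfolding A12_def matrix_matrix_mult_def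
  by (simp add: A_inf_nth d12_nth b12_nth flip_b12_nth mscale_nth distrib_right left_diff_distrib
      sum.distrib sum_subtractf mult.assoc sum_distrib_left[symmetric] sum_divide_distrib[symmetric] sum_delta_mult del: mult_if_delta)

lemma mult_D12_nth:
  "(M ** D12 \<gamma> w l) $ r $ (p, q) = M $ r $ (p, q) - (if p = q then 0 else \<gamma> / (l $ p - l $ q)) *
       (M $ r $ (p, q) + M $ r $ (q, p)) + \<gamma> / w * M $ r $ (q, p)"
proof -
  have d: "d12 $ s $ (p, q) = (if s = (q, p) then 1 else 0)" for s
    by (cases s) (auto simp: d12_nth)
  show ?thesis
    unfolding D12_def matrix_matrix_mult_def
    by (simp add: D_inf_nth d mscale_nth distrib_left right_diff_distrib
        sum.distrib sum_subtractf mult.left_commute sum_distrib_left[symmetric] sum_divide_distrib[symmetric] sum_delta_mult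
        del: mult_if_delta)
qed

text \<open>
  The entry \<open>((p, b), (p, q))\<close> of \<open>B\<^sub>1\<^sub>2 K\<^sub>2(\<lambda> + \<gamma> h\<^sub>1)\<close>. For \<open>b = p\<close> the fraction is
  \<open>(- \<gamma> K) / (- \<gamma>) = K\<close>, so that one formula covers both kinds of rows of \<open>B\<^sub>1\<^sub>2\<close>.
\<close>

definition BK ::
  "complex \<Rightarrow> complex \<Rightarrow> (complex^'n \<Rightarrow> complex^'n^'n) \<Rightarrow> complex^'n \<Rightarrow> 'n \<Rightarrow> 'n \<Rightarrow> 'n \<Rightarrow> complex"
  where "BK \<gamma> v X l p b q =
    ((l $ b - l $ p) * X (shift \<gamma> l p) $ b $ q - \<gamma> * X (shift \<gamma> l p) $ p $ q) / (l $ b - l $ p - \<gamma>)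
      - \<gamma> / (v + \<gamma>) * X (shift \<gamma> l p) $ p $ q"

lemma in2_shifted_nth:
  "in2_shifted \<gamma> X l $ (c, b) $ (p, q) = (if c = p then X (shift \<gamma> l p) $ b $ q else 0)"
proof -
  have "in2_shifted \<gamma> X l $ (c, b) $ (p, q)
      = (\<Sum>j\<in>UNIV. E j j $ c $ p * X (shift \<gamma> l j) $ b $ q)"
    by (simp add: in2_shifted_def kron_nth)
  also have "\<dots> = E p p $ c $ p * X (shift \<gamma> l p) $ b $ q"
    by (rule sum_UNIV_single) (simp add: E_nth)
  finally show ?thesis by (simp add: E_nth)
qed

lemma B12_mult_in2_shifted_nth:
  assumes "\<gamma> \<noteq> 0" "b \<noteq> p \<Longrightarrow> l $ b - l $ p \<noteq> \<gamma>"
  shows "(B12 \<gamma> v l ** in2_shifted \<gamma> X l) $ (c, b) $ (p, q) = (if c = p then BK \<gamma> v X l p b q else 0)"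
proof -
  have "(B12 \<gamma> v l ** in2_shifted \<gamma> X l) $ (c, b) $ (p, q)
      = in2_shifted \<gamma> X l $ (c, b) $ (p, q)
        + (if c = b then 0 else \<gamma> / (l $ b - l $ c - \<gamma>)) *
            (in2_shifted \<gamma> X l $ (c, b) $ (p, q) - in2_shifted \<gamma> X l $ (c, c) $ (p, q))
        - \<gamma> / (v + \<gamma>) * in2_shifted \<gamma> X l $ (c, c) $ (p, q)"
    unfolding B12_def matrix_matrix_mult_def
    by (simp add: B_inf_nth b12_nth mscale_nth distrib_right left_diff_distrib
        sum.distrib sum_subtractf mult.assoc sum_distrib_left[symmetric] sum_divide_distrib[symmetric] sum_delta_mult del: mult_if_delta)
  moreover have "x + \<gamma> / (l $ b - l $ p - \<gamma>) * (x - y)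
      = ((l $ b - l $ p) * x - \<gamma> * y) / (l $ b - l $ p - \<gamma>)" if "b \<noteq> p" for x y
    using assms(2)[OF that] by (simp add: field_simps)
  ultimately show ?thesis
    using assms(1) by (auto simp: in2_shifted_nth BK_def)
qed

lemma in1_B12_in2_shifted_nth:
  assumes "\<gamma> \<noteq> 0" "\<And>a b. a \<noteq> b \<Longrightarrow> l $ a - l $ b \<noteq> \<gamma>"
  shows "(in1 Y ** B12 \<gamma> v l ** in2_shifted \<gamma> X l) $ (a, b) $ (p, q) = Y $ a $ p * BK \<gamma> v X l p b q"
proof -
  have "(in1 Y ** (B12 \<gamma> v l ** in2_shifted \<gamma> X l)) $ (a, b) $ (p, q)
      = (\<Sum>s\<in>UNIV. in1 Y $ (a, b) $ s * (B12 \<gamma> v l ** in2_shifted \<gamma> X l) $ s $ (p, q))"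
    unfolding matrix_matrix_mult_def[of "in1 Y"] by simp
  also have "\<dots> = in1 Y $ (a, b) $ (p, b) * (B12 \<gamma> v l ** in2_shifted \<gamma> X l) $ (p, b) $ (p, q)"
    by (rule sum_UNIV_single)
      (auto simp: in1_def kron_nth mat_1_nth B12_mult_in2_shifted_nth[OF assms(1) assms(2)] split: if_splits)
  finally show ?thesis
    by (simp add: matrix_mul_assoc in1_def kron_nth mat_1_nth B12_mult_in2_shifted_nth[OF assms(1) assms(2)])
qed

section \<open>The right-hand side by exchanging the tensor factors\<close>

lemma flip_mult: "flip (M ** N) = flip M ** flip N"
proof -
  have "flip (M ** N) $ r $ s = (flip M ** flip N) $ r $ s" for r s
    unfolding flip_def matrix_matrix_mult_def
    by simp (rule sum.reindex_bij_witness[of _ prod.swap prod.swap], auto)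
  then show ?thesis by (simp add: vec_eq_iff)
qed

lemma flip_in1: "flip (in1 X) = in2 X"
  by (simp add: vec_eq_iff flip_nth in1_def in2_def kron_nth mult.commute)

lemma flip_in2_shifted: "flip (in2_shifted \<gamma> X l) = in1_shifted \<gamma> X l"
  by (simp add: vec_eq_iff flip_nth in1_shifted_def in2_shifted_def kron_nth mult.commute)

text \<open>Since C is the flip of B, this triple product is the flip of the one on the left-hand
  side, with both index pairs reversed.\<close>

lemma in2_C12_in1_shifted_nth:
  assumes "\<gamma> \<noteq> 0" "\<And>a b. a \<noteq> b \<Longrightarrow> l $ a - l $ b \<noteq> \<gamma>"
  shows "(in2 Y ** C12 \<gamma> u l ** in1_shifted \<gamma> X l) $ (a, b) $ (p, q) = Y $ b $ q * BK \<gamma> u X l q a p"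
proof -
  have "in2 Y ** C12 \<gamma> u l ** in1_shifted \<gamma> X l = flip (in1 Y ** B12 \<gamma> u l ** in2_shifted \<gamma> X l)"
    by (simp add: flip_mult flip_in1 flip_in2_shifted C12_def)
  then show ?thesis by (simp add: flip_nth in1_B12_in2_shifted_nth[OF assms])
qed

definition refl_at ::
  "complex \<Rightarrow> (complex \<Rightarrow> complex^'n::finite \<Rightarrow> complex^'n^'n) \<Rightarrow> complex \<Rightarrow> complex \<Rightarrow> complex^'n \<Rightarrow> bool" where
  "refl_at \<gamma> K u v l \<longleftrightarrow> A12 \<gamma> u v l ** in1 (K u l) ** B12 \<gamma> v l ** in2_shifted \<gamma> (K v) l
       = in2 (K v l) ** C12 \<gamma> u l ** in1_shifted \<gamma> (K u) l ** D12 \<gamma> (u - v) l"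

text \<open>The value 0 is excluded for the denominators of \<open>A_inf\<close> and
  \<open>D_inf\<close>, the value \<gamma> for those of \<open>B_inf\<close>. As a and b run over
  both orders, differences equal to -\<gamma> are excluded too.\<close>

definition nondegenerate :: "complex \<Rightarrow> complex^'n \<Rightarrow> bool" where
  "nondegenerate \<gamma> l \<longleftrightarrow> (\<forall>a b. a \<noteq> b \<longrightarrow> l $ a - l $ b \<noteq> 0 \<and> l $ a - l $ b \<noteq> \<gamma>)"

lemma refl_at_iff:
  fixes K :: "complex \<Rightarrow> complex^'n::finite \<Rightarrow> complex^'n^'n"
  assumes "\<gamma> \<noteq> 0" "nondegenerate \<gamma> l"
  defines "M \<equiv> \<lambda>u v a b p q. K u l $ a $ p * BK \<gamma> v (K v) l p b q"
  shows "refl_at \<gamma> K u v l \<longleftrightarrow> (\<forall>a b p q.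
     M u v a b p q + (if a = b then 0 else \<gamma> / (l $ a - l $ b)) *
       (M u v a b p q - M u v a a p q - M u v b b p q + M u v b a p q)
     + \<gamma> / (u - v) * M u v b a p q + \<gamma> / v * M u v a a p q - \<gamma> / (u + \<gamma>) * M u v b b p q
     = M v u b a q p - (if p = q then 0 else \<gamma> / (l $ p - l $ q)) *
       (M v u b a q p + M v u b a p q) + \<gamma> / (u - v) * M v u b a p q)"
proof -
  have nd: "\<And>a b. a \<noteq> b \<Longrightarrow> l $ a - l $ b \<noteq> \<gamma>"
    using assms(2) unfolding nondegenerate_def by blast
  show ?thesis
    unfolding refl_at_def vec_eq_iff split_paired_All matrix_mul_assoc[symmetric, of "A12 _ _ _ _"]
      A12_mult_nth mult_D12_nth
    by (simp add: matrix_mul_assoc in1_B12_in2_shifted_nth[OF assms(1) nd]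
        in2_C12_in1_shifted_nth[OF assms(1) nd] M_def)
qed

lemma generic_refl_at_iff:
  "reflection_eq \<gamma> K \<longleftrightarrow> generic (\<lambda>(u, v, l). refl_at \<gamma> K u v l)"
  unfolding reflection_eq_def refl_at_def ..

section \<open>Necessary conditions\<close>

lemma quadratic_zero_on_open:
  fixes a b c :: complex
  assumes "open U" "U \<noteq> {}" "\<And>u. u \<in> U \<Longrightarrow> a * u\<^sup>2 + b * u + c = 0"
  shows "a = 0" "b = 0" "c = 0"
proof -
  have "U \<subseteq> {u. poly [:c, b, a:] u = 0}"
    using assms(3) by (auto simp: power2_eq_square algebra_simps)
  moreover have "infinite U" using assms(1,2) finite_imp_not_open by blast
  ultimately have "[:c, b, a:] = 0" using poly_roots_finite finite_subset by blast
  then show "a = 0" "b = 0" "c = 0" by auto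
qed

text \<open>Makes it possible to fix \<lambda> and compare coefficients in u and v: the projection
  to \<lambda> is open and preserves density, and an open set contains a box around each of its
  points.\<close>

lemma generic_slice:
  assumes "generic (\<lambda>(u::'a::topological_space, v::'b::topological_space, l::'c::topological_space). Q u v l)"
  shows "generic (\<lambda>l. \<exists>U V. open U \<and> U \<noteq> {} \<and> open V \<and> V \<noteq> {} \<and> (\<forall>u\<in>U. \<forall>v\<in>V. Q u v l))"
proof -
  obtain S :: "('a \<times> 'b \<times> 'c) set"
    where S: "open S" "closure S = UNIV" "\<forall>(u, v, l)\<in>S. Q u v l"
    using assms unfolding generic_def by blast
  let ?T = "(\<lambda>z. snd (snd z)) ` S"
  have "?T = snd ` snd ` S" by (simp add: image_image)
  then have "open ?T" using open_image_snd[OF open_image_snd[OF S(1)]] by simp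
  moreover have "closure ?T = UNIV"
  proof -
    have "(\<lambda>z. snd (snd z)) ` closure S \<subseteq> closure ?T"
      by (rule image_closure_subset) (auto intro!: continuous_intros closure_subset)
    moreover have "(\<lambda>z. snd (snd z)) ` closure S = UNIV"
      unfolding S(2) by (auto simp: image_iff)
    ultimately show ?thesis by blast
  qed
  moreover have "\<exists>U V. open U \<and> U \<noteq> {} \<and> open V \<and> V \<noteq> {} \<and> (\<forall>u\<in>U. \<forall>v\<in>V. Q u v l)"
    if l: "l \<in> ?T" for l
  proof -
    obtain u v where uv: "(u, v, l) \<in> S" using l by auto
    obtain U R where U: "open U" "open R" "u \<in> U" "(v, l) \<in> R" "U \<times> R \<subseteq> S"
      by (rule open_prod_elim[OF S(1) uv]) auto
    obtain V L where V: "open V" "open L" "v \<in> V" "l \<in> L" "V \<times> L \<subseteq> R"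
      by (rule open_prod_elim[OF U(2,4)]) auto
    have "Q u' v' l" if "u' \<in> U" "v' \<in> V" for u' v'
      using that U V S(3) by blast
    then show ?thesis using U V by blast
  qed
  ultimately show ?thesis unfolding generic_def by blast
qed

text \<open>Besides the zeros of the spectral denominators, u - v = -\<gamma> is excluded, so that
  the factor 1 + \<gamma> / (u - v) common to both sides of a diagonal component can be
  cancelled.\<close>

lemma generic_spectral:
  fixes \<gamma> :: complex
  shows "generic (\<lambda>(u, v, l::'a::topological_space).
    u \<noteq> 0 \<and> v \<noteq> 0 \<and> u \<noteq> v \<and> u + \<gamma> \<noteq> 0 \<and> v + \<gamma> \<noteq> 0 \<and> u - v + \<gamma> \<noteq> 0)"
proof -
  have u: "generic (\<lambda>(u, v, l::'a). u \<noteq> g v)" if "continuous_on UNIV g" for g :: "complex \<Rightarrow> complex"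
  proof -
    have "continuous_on UNIV (\<lambda>y::complex \<times> 'a. g (fst y))"
      by (rule continuous_on_compose2[OF that]) (auto intro: continuous_intros)
    from generic_neq_fst[OF this] show ?thesis by (simp add: case_prod_unfold)
  qed
  have v: "generic (\<lambda>(u::complex, v::complex, l::'a). v \<noteq> c)" for c
  proof -
    have "generic (\<lambda>(v, l::'a). v \<noteq> c)" by (rule generic_neq_fst) auto
    from generic_snd[OF this] show ?thesis by simp
  qed
  have iff: "x + \<gamma> = 0 \<longleftrightarrow> x = -\<gamma>" "x - y + \<gamma> = 0 \<longleftrightarrow> x = y - \<gamma>" for x y
    by algebra+
  show ?thesis unfolding iff(2) unfolding iff(1)
    by (rule generic_mono[OF generic_conj[OF generic_conj[OF
        generic_conj[OF u[of "\<lambda>v. 0"] v[of 0]] generic_conj[OF u[of "\<lambda>v. v"] u[of "\<lambda>v. -\<gamma>"]]]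
        generic_conj[OF v[of "-\<gamma>"] u[of "\<lambda>v. v - \<gamma>"]]]])
      (auto intro!: continuous_intros)
qed

lemma generic_nondegenerate: "generic (nondegenerate \<gamma> :: complex^'n::finite \<Rightarrow> bool)"
proof -
  have "generic (\<lambda>l::complex^'n. a \<noteq> b \<longrightarrow> l $ a - l $ b \<noteq> 0 \<and> l $ a - l $ b \<noteq> \<gamma>)" for a b
    using generic_conj[OF generic_neq_component[of a b 0] generic_neq_component[of a b \<gamma>]]
    by (cases "a = b") (auto simp: generic_True)
  then have "generic (\<lambda>l::complex^'n. \<forall>a b. a \<noteq> b \<longrightarrow> l $ a - l $ b \<noteq> 0 \<and> l $ a - l $ b \<noteq> \<gamma>)"
    by (intro generic_all)
  then show ?thesis unfolding nondegenerate_def .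
qed

text \<open>
  Clearing denominators in the \<open>(a, a), (p, p)\<close> component, where the factor
  \<open>1 + \<gamma> / (u - v) + \<gamma> / v - \<gamma> / (u + \<gamma>)\<close> equals \<open>(u - v + \<gamma>) u (v + \<gamma>) / ((u - v) v (u + \<gamma>))\<close>.
\<close>

lemma diagonal_component_cleared:
  fixes u v \<gamma> :: complex
  assumes "u \<noteq> 0" "v \<noteq> 0" "u \<noteq> v" "u + \<gamma> \<noteq> 0" "v + \<gamma> \<noteq> 0" "u - v + \<gamma> \<noteq> 0"
    and eq: "(1 + \<gamma> / (u - v) + \<gamma> / v - \<gamma> / (u + \<gamma>)) *
        ((\<alpha> + \<gamma> / u * \<beta>) * (g + \<gamma> / v * h - \<gamma> / (v + \<gamma>) * (m + \<gamma> / v * n)))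
      = (1 + \<gamma> / (u - v)) * ((\<alpha> + \<gamma> / v * \<beta>) * (g + \<gamma> / u * h - \<gamma> / (u + \<gamma>) * (m + \<gamma> / u * n)))"
  defines "R \<equiv> \<lambda>w. g * w\<^sup>2 + \<gamma> * (g + h - m) * w + \<gamma>\<^sup>2 * (h - n)"
  shows "u * (\<alpha> * u + \<gamma> * \<beta>) * R v = v * (\<alpha> * v + \<gamma> * \<beta>) * R u"
proof -
  have 1: "1 + \<gamma> / (u - v) + \<gamma> / v - \<gamma> / (u + \<gamma>) = (u - v + \<gamma>) / (u - v) * (u * (v + \<gamma>) / (v * (u + \<gamma>)))"
    using assms(1-5) by (simp add: divide_simps) algebra
  have 2: "1 + \<gamma> / (u - v) = (u - v + \<gamma>) / (u - v)"
    using assms(3) by (simp add: divide_simps)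
  have 3: "\<alpha> + \<gamma> / w * \<beta> = (\<alpha> * w + \<gamma> * \<beta>) / w" if "w \<noteq> 0" for w
    using that by (simp add: divide_simps)
  have 4: "g + \<gamma> / w * h - \<gamma> / (w + \<gamma>) * (m + \<gamma> / w * n) = R w / (w * (w + \<gamma>))"
    if "w \<noteq> 0" "w + \<gamma> \<noteq> 0" for w
    unfolding R_def using that by (simp add: divide_simps) algebra
  \<comment> \<open>The only factor mixing u and v appears on both sides; once it is cancelled the
    variables separate.\<close>
  have "(u - v + \<gamma>) / (u - v) \<noteq> 0" using assms(3,6) by simp
  then have "u * (v + \<gamma>) / (v * (u + \<gamma>)) * ((\<alpha> * u + \<gamma> * \<beta>) / u * (R v / (v * (v + \<gamma>))))
      = (\<alpha> * v + \<gamma> * \<beta>) / v * (R u / (u * (u + \<gamma>)))"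
    using eq[unfolded 1, unfolded 2 3[OF assms(1)] 3[OF assms(2)] 4[OF assms(1,4)] 4[OF assms(2,5)]]
    by (simp only: mult.assoc mult_cancel_left) blast
  then show ?thesis using assms(1,2,4,5) by (simp add: divide_simps) algebra
qed

text \<open>The hypothesis makes the quadratics
  \<open>w * (\<alpha> * w + \<gamma> * \<beta>)\<close> and \<open>R w\<close> proportional. The
  conclusions are two of the resulting 2x2 minors of their coefficient vectors; the zero constant
  term of the first quadratic produces the first one. The proof compares the coefficients of u
  squared.\<close>

lemma separated_quadratic:
  fixes \<alpha> \<beta> \<gamma> g h m n :: complex
  assumes "\<gamma> \<noteq> 0" "open U" "U \<noteq> {}" "open V" "V \<noteq> {}"
  defines "R \<equiv> \<lambda>w. g * w\<^sup>2 + \<gamma> * (g + h - m) * w + \<gamma>\<^sup>2 * (h - n)"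
  assumes "\<forall>u\<in>U. \<forall>v\<in>V. u * (\<alpha> * u + \<gamma> * \<beta>) * R v = v * (\<alpha> * v + \<gamma> * \<beta>) * R u"
  shows "\<alpha> * (h - n) = 0" "\<alpha> * (g + h - m) = \<beta> * g"
proof -
  have "0 * v\<^sup>2 + (\<alpha> * \<gamma> * (g + h - m) - \<gamma> * \<beta> * g) * v + \<alpha> * \<gamma>\<^sup>2 * (h - n) = 0" if "v \<in> V" for v
  proof -
    have "(\<alpha> * R v - g * v * (\<alpha> * v + \<gamma> * \<beta>)) * u\<^sup>2
        + (\<gamma> * \<beta> * R v - v * (\<alpha> * v + \<gamma> * \<beta>) * \<gamma> * (g + h - m)) * u
        + (- (v * (\<alpha> * v + \<gamma> * \<beta>) * \<gamma>\<^sup>2 * (h - n))) = 0" if "u \<in> U" for u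
      using assms(7)[rule_format, OF that \<open>v \<in> V\<close>] unfolding R_def by algebra
    from quadratic_zero_on_open(1)[OF assms(2,3) this]
    show ?thesis unfolding R_def by algebra
  qed
  note * = quadratic_zero_on_open[OF assms(4,5) this]
  show "\<alpha> * (h - n) = 0" using *(3) assms(1) by simp
  have "\<gamma> * (\<alpha> * (g + h - m)) = \<gamma> * (\<beta> * g)" using *(2) by (simp add: algebra_simps)
  then show "\<alpha> * (g + h - m) = \<beta> * g" using assms(1) by simp
qed

text \<open>The limit of \<open>BK \<gamma> v X l p b p\<close> as \<open>v \<rightarrow> \<infinity>\<close>.\<close>

definition BK0 :: "complex \<Rightarrow> (complex^'n \<Rightarrow> complex^'n^'n) \<Rightarrow> complex^'n \<Rightarrow> 'n \<Rightarrow> 'n \<Rightarrow> complex" where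
  "BK0 \<gamma> X l p b = ((l $ b - l $ p) * X (shift \<gamma> l p) $ b $ p - \<gamma> * X (shift \<gamma> l p) $ p $ p)
     / (l $ b - l $ p - \<gamma>)"

lemma BK_K_ansatz:
  "BK \<gamma> v (K_ansatz \<gamma> k0 k1 v) l p b p = BK0 \<gamma> k0 l p b + \<gamma> / v * BK0 \<gamma> k1 l p b
     - \<gamma> / (v + \<gamma>) * (k0 (shift \<gamma> l p) $ p $ p + \<gamma> / v * k1 (shift \<gamma> l p) $ p $ p)"
proof -
  have lin: "(d * (x + e * x') - \<gamma> * (y + e * y')) / (d - \<gamma>)
      = (d * x - \<gamma> * y) / (d - \<gamma>) + e * ((d * x' - \<gamma> * y') / (d - \<gamma>))" for d x x' y y' e :: complex
    by (simp add: add_divide_distrib diff_divide_distrib algebra_simps)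
  show ?thesis unfolding BK_def BK0_def K_ansatz_def vector_add_component mscale_nth lin ..
qed

lemma reflection_ansatz_necessary:
  fixes k0 k1 :: "complex^'n::finite \<Rightarrow> complex^'n^'n"
  assumes "\<gamma> \<noteq> 0" "reflection_eq \<gamma> (K_ansatz \<gamma> k0 k1)" "\<And>i j. generic (\<lambda>l. k0 l $ i $ j \<noteq> 0)"
  shows "generic (\<lambda>l. \<forall>a p. k1 l $ a $ p = k1 l $ p $ p \<and>
    (k0 l $ a $ p - k1 l $ a $ p) * BK0 \<gamma> k0 l p a
      = k0 l $ a $ p * (k0 (shift \<gamma> l p) $ p $ p - k1 (shift \<gamma> l p) $ p $ p))"
proof -
  let ?K = "K_ansatz \<gamma> k0 k1"
  let ?n = "\<lambda>l p. k1 (shift \<gamma> l p) $ p $ p" and ?m = "\<lambda>l p. k0 (shift \<gamma> l p) $ p $ p"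
  let ?P = "\<lambda>l a p. k1 (shift \<gamma> l p) $ a $ p = ?n l p \<and>
    (k0 l $ a $ p - k1 l $ a $ p) * BK0 \<gamma> k0 l p a = k0 l $ a $ p * (?m l p - ?n l p)"
  have "generic (\<lambda>(u, v, l). refl_at \<gamma> ?K u v l)"
    using assms(2) unfolding generic_refl_at_iff .
  from generic_slice[OF generic_mono[OF generic_conj[OF this generic_spectral[of \<gamma>]],
      of "\<lambda>(u, v, l). refl_at \<gamma> ?K u v l \<and> u \<noteq> 0 \<and> v \<noteq> 0 \<and> u \<noteq> v \<and> u + \<gamma> \<noteq> 0 \<and> v + \<gamma> \<noteq> 0 \<and> u - v + \<gamma> \<noteq> 0"]]
  have "generic (\<lambda>l. \<exists>U V. open U \<and> U \<noteq> {} \<and> open V \<and> V \<noteq> {} \<and> (\<forall>u\<in>U. \<forall>v\<in>V.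
      refl_at \<gamma> ?K u v l \<and> u \<noteq> 0 \<and> v \<noteq> 0 \<and> u \<noteq> v \<and> u + \<gamma> \<noteq> 0 \<and> v + \<gamma> \<noteq> 0 \<and> u - v + \<gamma> \<noteq> 0))"
    by auto
  moreover have "generic (\<lambda>l. \<forall>i j. k0 l $ i $ j \<noteq> 0)" using assms(3) by (intro generic_all)
  ultimately have *: "generic (\<lambda>l. \<forall>a p. ?P l a p)"
  proof (rule generic_mono[OF generic_conj[OF generic_conj[OF _ _] generic_nondegenerate[of \<gamma>]]], goal_cases)
    case (1 l)
    then obtain U V where UV: "open U" "U \<noteq> {}" "open V" "V \<noteq> {}"
      "\<And>u v. u \<in> U \<Longrightarrow> v \<in> V \<Longrightarrow> refl_at \<gamma> ?K u v l \<and> u \<noteq> 0 \<and> v \<noteq> 0 \<and> u \<noteq> v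
        \<and> u + \<gamma> \<noteq> 0 \<and> v + \<gamma> \<noteq> 0 \<and> u - v + \<gamma> \<noteq> 0"
      by blast
    have k0: "k0 l $ i $ j \<noteq> 0" for i j using 1 by blast
    have ndl: "nondegenerate \<gamma> l" using 1 by blast
    have nd: "\<And>a b. a \<noteq> b \<Longrightarrow> l $ a - l $ b \<noteq> \<gamma>" "\<And>a b. a \<noteq> b \<Longrightarrow> l $ a - l $ b \<noteq> 0"
      using 1 unfolding nondegenerate_def by blast+
    show ?case
    proof (intro allI)
      fix a p
      let ?g = "BK0 \<gamma> k0 l p a" and ?h = "BK0 \<gamma> k1 l p a"
      let ?R = "\<lambda>w. ?g * w\<^sup>2 + \<gamma> * (?g + ?h - ?m l p) * w + \<gamma>\<^sup>2 * (?h - ?n l p)"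
      have "u * (k0 l $ a $ p * u + \<gamma> * k1 l $ a $ p) * ?R v = v * (k0 l $ a $ p * v + \<gamma> * k1 l $ a $ p) * ?R u"
        if "u \<in> U" "v \<in> V" for u v
      proof (rule diagonal_component_cleared)
        show "u \<noteq> 0" "v \<noteq> 0" "u \<noteq> v" "u + \<gamma> \<noteq> 0" "v + \<gamma> \<noteq> 0" "u - v + \<gamma> \<noteq> 0"
          using UV(5)[OF that] by auto
        have refl: "refl_at \<gamma> ?K u v l" using UV(5)[OF that] by blast
        let ?M = "\<lambda>u v. ?K u l $ a $ p * BK \<gamma> v (?K v) l p a p"
        have M: "?M u v = (k0 l $ a $ p + \<gamma> / u * k1 l $ a $ p)
            * (?g + \<gamma> / v * ?h - \<gamma> / (v + \<gamma>) * (?m l p + \<gamma> / v * ?n l p))" for u v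
          unfolding BK_K_ansatz by (simp add: K_ansatz_def mscale_nth)
        \<comment> \<open>For a = b and p = q both \<lambda>-dependent corrections are zero and each
          side contains a single product.\<close>
        have "?M u v + \<gamma> / (u - v) * ?M u v + \<gamma> / v * ?M u v - \<gamma> / (u + \<gamma>) * ?M u v
            = ?M v u + \<gamma> / (u - v) * ?M v u"
          using refl[unfolded refl_at_iff[OF assms(1) ndl], rule_format, of a p a p] by simp
        then have "(1 + \<gamma> / (u - v) + \<gamma> / v - \<gamma> / (u + \<gamma>)) * ?M u v = (1 + \<gamma> / (u - v)) * ?M v u"
          by (simp add: distrib_right left_diff_distrib)
        then show "(1 + \<gamma> / (u - v) + \<gamma> / v - \<gamma> / (u + \<gamma>)) *
            ((k0 l $ a $ p + \<gamma> / u * k1 l $ a $ p)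
              * (?g + \<gamma> / v * ?h - \<gamma> / (v + \<gamma>) * (?m l p + \<gamma> / v * ?n l p)))
          = (1 + \<gamma> / (u - v)) * ((k0 l $ a $ p + \<gamma> / v * k1 l $ a $ p)
              * (?g + \<gamma> / u * ?h - \<gamma> / (u + \<gamma>) * (?m l p + \<gamma> / u * ?n l p)))"
          unfolding M .
      qed
      then have "\<forall>u\<in>U. \<forall>v\<in>V. u * (k0 l $ a $ p * u + \<gamma> * k1 l $ a $ p) * ?R v
          = v * (k0 l $ a $ p * v + \<gamma> * k1 l $ a $ p) * ?R u"
        by blast
      note sep = separated_quadratic[OF assms(1) UV(1-4) this]
      have hn: "?h = ?n l p" using sep(1) k0[of a p] by simp
      \<comment> \<open>Clearing the denominator in \<open>BK0\<close> cancels the \<gamma> terms of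
        \<open>?h = ?n l p\<close> and leaves the two entries multiplied by the nonzero difference
        of coordinates.\<close>
      have "k1 (shift \<gamma> l p) $ a $ p = ?n l p"
      proof (cases "a = p")
        case False
        then have "(l $ a - l $ p) * k1 (shift \<gamma> l p) $ a $ p = (l $ a - l $ p) * ?n l p"
          using hn nd(1)[OF False] unfolding BK0_def by (simp add: field_simps)
        then show ?thesis using nd(2)[OF False] by simp
      qed simp
      moreover have "(k0 l $ a $ p - k1 l $ a $ p) * ?g = k0 l $ a $ p * (?m l p - ?n l p)"
        using sep(2) unfolding hn by algebra
      ultimately show "?P l a p" ..
    qed
  qed
  \<comment> \<open>Constancy of column p was obtained at the argument shifted in direction p, and
    the shift is undone one column at a time.\<close>
  have "generic (\<lambda>l. k1 l $ a $ p = k1 l $ p $ p)" for a p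
    by (rule generic_unshift[of _ \<gamma> p], rule generic_mono[OF *]) blast
  then have "generic (\<lambda>l. \<forall>a p. k1 l $ a $ p = k1 l $ p $ p)" by (intro generic_all)
  from generic_conj[OF * this] show ?thesis by (rule generic_mono) blast
qed

section \<open>The rational identity behind the solutions\<close>

text \<open>
  The identity is homogeneous in \<open>(X, Y, k)\<close> in order to allow \<open>x + d = 0\<close> or \<open>y + d = 0\<close>, which
  occurs in type IIb for \<open>f = -\<gamma>\<close>. In terms of the reciprocals \<open>a, b, U, V, P, Q, W\<close> below it
  becomes polynomial and follows from partial fraction relations between them.
\<close>

lemma reflection_identity:
  fixes x y X Y k d u v g :: complex
  assumes nz: "x \<noteq> 0" "y \<noteq> 0" "d \<noteq> 0" "u \<noteq> 0" "v \<noteq> 0" "u + g \<noteq> 0" "v + g \<noteq> 0" "u \<noteq> v"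
    and X: "(x + d) * X = k" and Y: "(y + d) * Y = k"
  shows "(1/x - 1/u) * (Y - k/(v+g)) + g * (Y - X) / (x * y)
    + g/(u-v) * ((1/y - 1/u) * (X - k/(v+g)))
    + g/v * ((1/x - 1/u) * (X - k/(v+g)))
    - g/(u+g) * ((1/y - 1/u) * (Y - k/(v+g)))
    = (1 - g/d) * ((Y - k/v) * (1/x - 1/(u+g))) + (g/(u-v) + g/d) * ((1/y - 1/v) * (X - k/(u+g)))"
proof -
  define a b U V P Q W D where "a = 1/x" and "b = 1/y" and "U = 1/u" and "V = 1/v"
    and "P = 1/(u+g)" and "Q = 1/(v+g)" and "W = 1/(u-v)" and "D = 1/d"
  note defs = a_def b_def U_def V_def P_def Q_def W_def D_def
  have uv: "u - v \<noteq> 0" using nz by simp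
  have "a * x = 1" "b * y = 1" using nz by (simp_all add: defs)
  then have ka: "k * a = X + d * (a * X)" and kb: "k * b = Y + d * (b * Y)"
    using X Y by algebra+
  have Dd: "D * d = 1" using nz by (simp add: defs)
  have UP: "g * (U * P) = U - P" and VQ: "g * (V * Q) = V - Q"
    using nz by (simp_all add: defs divide_simps)
  have VU: "W * (V - U) = U * V" and QP: "W * (Q - P) = P * Q"
    using nz uv by (simp_all add: defs divide_simps)
  have UQVP: "W * (U * Q - V * P) = - g * (U * V * P * Q)"
    using nz uv by (simp add: defs divide_simps) algebra
  \<comment> \<open>The terms with a pole at u = v have the same residue on both sides, so their
    difference is polynomial in the remaining reciprocals.\<close>
  have w: "W * ((b - U) * (X - k * Q) - (b - V) * (X - k * P))
      = - k * b * (P * Q) + X * (U * V) - k * g * (U * V * P * Q)"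
  proof -
    have "W * ((b - U) * (X - k * Q) - (b - V) * (X - k * P))
        = - k * b * (W * (Q - P)) + X * (W * (V - U)) + k * (W * (U * Q - V * P))"
      by (simp add: algebra_simps)
    then show ?thesis unfolding VU QP UQVP by simp
  qed
  \<comment> \<open>The same cancellation for the pole at d = 0; here the relations between X, Y and
    k supply the factor d.\<close>
  have D: "D * ((Y - k * V) * (a - P) - (b - V) * (X - k * P))
      = a * b * (X - Y) + P * (b * Y) - V * (a * X)"
  proof -
    have "(Y - k * V) * (a - P) - (b - V) * (X - k * P)
        = a * Y - b * X + P * (k * b - Y) - V * (k * a - X)"
      by (simp add: algebra_simps)
    also have "a * Y - b * X = d * (a * b * (X - Y))" using ka kb by algebra
    also have "k * b - Y = d * (b * Y)" unfolding kb by simp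
    also have "k * a - X = d * (a * X)" unfolding ka by simp
    finally have "(Y - k * V) * (a - P) - (b - V) * (X - k * P)
        = d * (a * b * (X - Y) + P * (b * Y) - V * (a * X))"
      by (simp add: algebra_simps)
    then show ?thesis using Dd by (simp flip: mult.assoc)
  qed
  \<comment> \<open>Without W and D, the partial fractions relating u to u + g and v to v + g
    suffice.\<close>
  have "(a - U) * (Y - k * Q) + g * (a * b * (Y - X)) + g * (V * ((a - U) * (X - k * Q)))
        - g * (P * ((b - U) * (Y - k * Q))) - (Y - k * V) * (a - P)
      + g * (- k * b * (P * Q) + X * (U * V) - k * g * (U * V * P * Q))
      + g * (a * b * (X - Y) + P * (b * Y) - V * (a * X))
      = - k * a * (Q + g * (V * Q)) - U * Y + k * U * Q - k * (g * (U * P) * (g * (V * Q)))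
        + k * U * (g * (V * Q)) + Y * (g * (U * P)) - k * Q * (g * (U * P))
        + Y * P + k * V * a - k * V * P"
    by (simp add: algebra_simps)
  also have "\<dots> = 0" unfolding UP VQ by (simp add: algebra_simps)
  finally have z: "(a - U) * (Y - k * Q) + g * (a * b * (Y - X)) + g * (V * ((a - U) * (X - k * Q)))
        - g * (P * ((b - U) * (Y - k * Q))) - (Y - k * V) * (a - P)
      + g * (W * ((b - U) * (X - k * Q) - (b - V) * (X - k * P)))
      + g * (D * ((Y - k * V) * (a - P) - (b - V) * (X - k * P))) = 0"
    unfolding w D .
  have "(a - U) * (Y - k * Q) + g * (Y - X) * (a * b) + g * W * ((b - U) * (X - k * Q))
      + g * V * ((a - U) * (X - k * Q)) - g * P * ((b - U) * (Y - k * Q))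
      = (1 - g * D) * ((Y - k * V) * (a - P)) + (g * W + g * D) * ((b - V) * (X - k * P))"
    using z by algebra
  then show ?thesis by (simp add: defs)
qed

section \<open>Solutions\<close>

text \<open>The assumption \<open>exchange\<close> is what remains of the reflection equation after
  \<open>reflection_identity\<close> has rewritten the left-hand side and the \<gamma> / (u - v)
  terms have cancelled. It no longer mixes different rows by differences of coordinates and only
  compares the column orders (p, q) and (q, p).\<close>

lemma refl_at_factorized:
  fixes K :: "complex \<Rightarrow> complex^'n::finite \<Rightarrow> complex^'n^'n"
  assumes "\<gamma> \<noteq> 0" "nondegenerate \<gamma> l"
    and uv: "u \<noteq> 0" "v \<noteq> 0" "u + \<gamma> \<noteq> 0" "v + \<gamma> \<noteq> 0" "u \<noteq> v"
    and M: "\<And>u v a b p q. v \<noteq> 0 \<Longrightarrow> v + \<gamma> \<noteq> 0 \<Longrightarrow>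
      K u l $ a $ p * BK \<gamma> v (K v) l p b q = c p q * ((1 / X p a - 1 / u) * (Y p q b - k p q / (v + \<gamma>)))"
    and X: "\<And>p a. X p a \<noteq> 0" "\<And>p a b. X p b - X p a = l $ a - l $ b"
    and d: "\<And>p q. d p q \<noteq> 0" "\<And>p q a. (X p a + d p q) * Y p q a = k p q"
    and exchange: "\<And>a b p q. (1 - (if p = q then 0 else \<gamma> / (l $ p - l $ q))) *
        (c q p * ((1 / X q b - 1 / v) * (Y q p a - k q p / (u + \<gamma>))))
      = c p q * ((1 - \<gamma> / d p q) * ((Y p q b - k p q / v) * (1 / X p a - 1 / (u + \<gamma>)))
          + (\<gamma> / d p q + (if p = q then 0 else \<gamma> / (l $ p - l $ q)))
            * ((1 / X p b - 1 / v) * (Y p q a - k p q / (u + \<gamma>))))"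
  shows "refl_at \<gamma> K u v l"
  unfolding refl_at_iff[OF assms(1,2)] M[OF uv(1,3)] M[OF uv(2,4)]
proof (intro allI)
  fix a b p q
  let ?\<kappa> = "if p = q then 0 else \<gamma> / (l $ p - l $ q)"
  let ?m = "\<lambda>a b. (1 / X p a - 1 / u) * (Y p q b - k p q / (v + \<gamma>))"
  \<comment> \<open>The alternating sum over rows factors into two differences, and the difference
    of the reciprocals of X cancels the denominator from A.\<close>
  have ex: "(if a = b then 0 else \<gamma> / (l $ a - l $ b)) * (?m a b - ?m a a - ?m b b + ?m b a)
      = \<gamma> * (Y p q b - Y p q a) / (X p a * X p b)"
  proof (cases "a = b")
    case False
    then have ne: "X p b - X p a \<noteq> 0"
      using assms(2) unfolding X(2) nondegenerate_def by blast
    have "?m a b - ?m a a - ?m b b + ?m b a = (1 / X p a - 1 / X p b) * (Y p q b - Y p q a)"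
      by algebra
    also have "1 / X p a - 1 / X p b = (X p b - X p a) / (X p a * X p b)"
      using X(1) by (simp add: divide_simps)
    finally show ?thesis using False ne unfolding X(2)[of p b a, symmetric] by simp
  qed simp
  have "c p q * ?m a b + (if a = b then 0 else \<gamma> / (l $ a - l $ b)) *
        (c p q * ?m a b - c p q * ?m a a - c p q * ?m b b + c p q * ?m b a)
      + \<gamma> / (u - v) * (c p q * ?m b a) + \<gamma> / v * (c p q * ?m a a) - \<gamma> / (u + \<gamma>) * (c p q * ?m b b)
    = c p q * (?m a b + (if a = b then 0 else \<gamma> / (l $ a - l $ b)) * (?m a b - ?m a a - ?m b b + ?m b a)
      + \<gamma> / (u - v) * ?m b a + \<gamma> / v * ?m a a - \<gamma> / (u + \<gamma>) * ?m b b)"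
    by algebra
  also have "\<dots> = c p q * ((1 - \<gamma> / d p q) * ((Y p q b - k p q / v) * (1 / X p a - 1 / (u + \<gamma>)))
      + (\<gamma> / (u - v) + \<gamma> / d p q) * ((1 / X p b - 1 / v) * (Y p q a - k p q / (u + \<gamma>))))"
    unfolding ex
    by (subst reflection_identity[OF X(1) X(1) d(1) uv(1,2,3,4,5) d(2) d(2)]) simp
  also have "\<dots> = (1 - ?\<kappa>) * (c q p * ((1 / X q b - 1 / v) * (Y q p a - k q p / (u + \<gamma>))))
      + (\<gamma> / (u - v) - ?\<kappa>) * (c p q * ((1 / X p b - 1 / v) * (Y p q a - k p q / (u + \<gamma>))))"
    unfolding exchange by algebra
  finally show "c p q * ?m a b + (if a = b then 0 else \<gamma> / (l $ a - l $ b)) *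
        (c p q * ?m a b - c p q * ?m a a - c p q * ?m b b + c p q * ?m b a)
      + \<gamma> / (u - v) * (c p q * ?m b a) + \<gamma> / v * (c p q * ?m a a) - \<gamma> / (u + \<gamma>) * (c p q * ?m b b)
    = c q p * ((1 / X q b - 1 / v) * (Y q p a - k q p / (u + \<gamma>)))
      - ?\<kappa> * (c q p * ((1 / X q b - 1 / v) * (Y q p a - k q p / (u + \<gamma>)))
          + c p q * ((1 / X p b - 1 / v) * (Y p q a - k p q / (u + \<gamma>))))
      + \<gamma> / (u - v) * (c p q * ((1 / X p b - 1 / v) * (Y p q a - k p q / (u + \<gamma>))))"
    by algebra
qed

text \<open>Here w and z are the denominators in rows p and b of the shifted column. The relation
  between d, w and z makes the numerator divisible by d - \<gamma>, so the pole of B cancels; this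
  is the source of the factorization of \<open>BK\<close>.\<close>

lemma BK_fraction:
  fixes c d w z v \<gamma> :: complex
  assumes "z \<noteq> 0" "w \<noteq> 0" "v \<noteq> 0" "v + \<gamma> \<noteq> 0" "d = w + \<gamma> - z" "d \<noteq> \<gamma>"
  shows "(d * (c * (1/z - 1/v)) - \<gamma> * (c * (1/w - 1/v))) / (d - \<gamma>) - \<gamma> / (v + \<gamma>) * (c * (1/w - 1/v))
    = c / w * ((w + \<gamma>) / z - (w + \<gamma>) / (v + \<gamma>))"
proof -
  have dg: "d - \<gamma> \<noteq> 0" using assms(6) by simp
  have "d * (1/z - 1/v) - \<gamma> * (1/w - 1/v) = (d - \<gamma>) * ((w + \<gamma>) / (w * z) - 1 / v)"
    using assms(1-3) unfolding assms(5) by (simp add: divide_simps) algebra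
  then have "d * (c * (1/z - 1/v)) - \<gamma> * (c * (1/w - 1/v)) = (d - \<gamma>) * (c * ((w + \<gamma>) / (w * z) - 1 / v))"
    by algebra
  then have "(d * (c * (1/z - 1/v)) - \<gamma> * (c * (1/w - 1/v))) / (d - \<gamma>) = c * ((w + \<gamma>) / (w * z) - 1 / v)"
    using dg by simp
  moreover have "c * ((w + \<gamma>) / (w * z) - 1 / v) - \<gamma> / (v + \<gamma>) * (c * (1/w - 1/v))
    = c / w * ((w + \<gamma>) / z - (w + \<gamma>) / (v + \<gamma>))"
    using assms(1-4) by (simp add: divide_simps) algebra
  ultimately show ?thesis by simp
qed

lemma BK_fraction_diagonal:
  fixes c w v \<gamma> :: complex
  assumes "w \<noteq> 0" "v \<noteq> 0" "v + \<gamma> \<noteq> 0"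
  shows "c * (1/w - 1/v) - \<gamma> / (v + \<gamma>) * (c * (1/w - 1/v)) = c / w * (1 - (w + \<gamma>) / (v + \<gamma>))"
  using assms by (simp add: divide_simps) algebra

lemma BK0_fraction:
  fixes c d w z \<gamma> :: complex
  assumes "z \<noteq> 0" "w \<noteq> 0" "d = w + \<gamma> - z" "d \<noteq> \<gamma>"
  shows "(d * (c / z) - \<gamma> * (c / w)) / (d - \<gamma>) = c / w * ((w + \<gamma>) / z)"
proof -
  have "d * (c / z) - \<gamma> * (c / w) = (d - \<gamma>) * (c / w * ((w + \<gamma>) / z))"
    using assms(1,2) unfolding assms(3) by (simp add: divide_simps) algebra
  then show ?thesis using assms(4) by simp
qed

text \<open>The counterpart for columns of type (a). Only the entry in row p is raised by \<gamma>
  under the shift, and the combination in \<open>BK0\<close> raises every row in the same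
  way.\<close>

lemma BK0_linear:
  fixes c d y y' \<gamma> :: complex
  assumes "d = y - y'" "d \<noteq> \<gamma>"
  shows "(d * (c * y) - \<gamma> * (c * (y' + \<gamma>))) / (d - \<gamma>) = c * (y + \<gamma>)"
proof -
  have "d * (c * y) - \<gamma> * (c * (y' + \<gamma>)) = (d - \<gamma>) * (c * (y + \<gamma>))"
    unfolding assms(1) by algebra
  then show ?thesis using assms(2) by simp
qed

text \<open>Common form of the column factors, with \<open>h x\<close> equal to
  \<open>\<gamma> / x\<close> or \<open>1 + F / x\<close>. In type IIb, F is the number
  \<open>f l\<close>; periodicity allows the same h at the shifted argument.\<close>

definition dprod :: "(complex \<Rightarrow> complex) \<Rightarrow> complex^'n::finite \<Rightarrow> 'n \<Rightarrow> complex" where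
  "dprod h l j = (\<Prod>a\<in>UNIV - {j}. h (l $ j - l $ a))"

text \<open>For q distinct from p only the factor belonging to p changes. The cross-multiplied form
  needs no factor to be nonzero.\<close>

lemma dprod_shift:
  assumes "p \<noteq> q"
  shows "dprod h (shift \<gamma> l p) q * h (l $ q - l $ p) = dprod h l q * h (l $ q - l $ p - \<gamma>)"
proof -
  have r: "dprod h m q = h (m $ q - m $ p) * (\<Prod>a\<in>UNIV - {q} - {p}. h (m $ q - m $ a))" for m
    unfolding dprod_def using assms by (subst prod.remove[of _ p]) auto
  have "(\<Prod>a\<in>UNIV - {q} - {p}. h (shift \<gamma> l p $ q - shift \<gamma> l p $ a))
      = (\<Prod>a\<in>UNIV - {q} - {p}. h (l $ q - l $ a))"
    using assms by (intro prod.cong) (auto simp: shift_nth)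
  then show ?thesis unfolding r[of "shift \<gamma> l p"] r[of l] using assms
    by (simp add: shift_nth algebra_simps)
qed

lemma dprod_nonzero:
  assumes "\<And>a. a \<noteq> j \<Longrightarrow> h (l $ j - l $ a) \<noteq> 0"
  shows "dprod h l j \<noteq> 0"
  unfolding dprod_def using assms by auto

lemma nondegenerate_shift_diff:
  assumes "nondegenerate \<gamma> l" "a \<noteq> p"
  shows "shift \<gamma> l p $ p - shift \<gamma> l p $ a \<noteq> 0"
proof
  assume "shift \<gamma> l p $ p - shift \<gamma> l p $ a = 0"
  then have "l $ a - l $ p = \<gamma>" using assms(2) by (simp add: shift_nth algebra_simps)
  then show False using assms unfolding nondegenerate_def by blast
qed

lemma Lam_shift: "Lam (shift \<gamma> l p) i = Lam l i + (if i = p then 0 else \<gamma>)"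
proof -
  have "(\<Sum>a\<in>UNIV. shift \<gamma> l p $ a) = (\<Sum>a\<in>UNIV. l $ a) + (\<Sum>a\<in>UNIV. if a = p then \<gamma> else 0)"
    unfolding sum.distrib[symmetric] by (intro sum.cong) (auto simp: shift_nth)
  then show ?thesis by (simp add: Lam_def shift_nth)
qed

text \<open>\<open>Lam2 l i p\<close> does not involve the coordinate p when i differs from p,
  whereas for i = p that coordinate enters with coefficient -1.\<close>

lemma Lam2_shift: "Lam2 (shift \<gamma> l p) i p = Lam2 l i p - (if i = p then \<gamma> else 0)"
proof -
  have "Lam2 m i p = Lam m i - m $ p" for m :: "complex^'a"
    by (simp add: Lam2_def Lam_def)
  then show ?thesis by (simp add: Lam_shift shift_nth)
qed

lemma Lam_diff: "Lam l b - Lam l a = l $ a - l $ b"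
  by (simp add: Lam_def)

section \<open>Verification of the claimed solutions\<close>

lemma K_Ib_nth: "K_Ib \<gamma> f u l $ i $ j
    = (f l + Lam l j) * dprod (\<lambda>x. \<gamma> / x) l j * (1 / (f l + Lam l i) - 1 / u)"
  by (simp add: K_Ib_def dprod_def)

lemma K_IIb_nth: "K_IIb f u l $ i $ j
    = f l * dprod (\<lambda>x. 1 + f l / x) l j * (1 / (f l - (l $ i - l $ j)) - 1 / u)"
  by (simp add: K_IIb_def dprod_def)

lemma refl_at_K_Ib:
  fixes f :: "complex^'n::finite \<Rightarrow> complex"
  assumes "\<gamma> \<noteq> 0" "nondegenerate \<gamma> l"
    and uv: "u \<noteq> 0" "v \<noteq> 0" "u + \<gamma> \<noteq> 0" "v + \<gamma> \<noteq> 0" "u \<noteq> v"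
    and f: "\<And>p. f (shift \<gamma> l p) = f l"
    and nz: "\<And>a. f l + Lam l a \<noteq> 0" "\<And>a. f l + Lam l a + \<gamma> \<noteq> 0"
  shows "refl_at \<gamma> (K_Ib \<gamma> f) u v l"
proof -
  define x where "x a = f l + Lam l a" for a
  let ?P = "dprod (\<lambda>x. \<gamma> / x) l" and ?S = "\<lambda>p. dprod (\<lambda>x. \<gamma> / x) (shift \<gamma> l p)"
  have x0: "x a \<noteq> 0" "x a + \<gamma> \<noteq> 0" for a using nz unfolding x_def by auto
  have xd: "x b - x a = l $ a - l $ b" for a b unfolding x_def using Lam_diff[of l b a] by simp
  \<comment> \<open>The factor \<open>x p\<close> of the column of K has been cancelled against the
    denominator that \<open>BK_fraction\<close> produces.\<close>
  define c where "c p q = ?P p * ((x q + (if q = p then 0 else \<gamma>)) * ?S p q) * (x p + \<gamma>)" for p q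
  have BK: "BK \<gamma> v (K_Ib \<gamma> f v) l p b q = (x q + (if q = p then 0 else \<gamma>)) * ?S p q * (x p + \<gamma>) / x p
      * (1 / (x b + \<gamma>) - 1 / (v + \<gamma>))" if v: "v \<noteq> 0" "v + \<gamma> \<noteq> 0" for v p b q
  proof -
    let ?c = "(x q + (if q = p then 0 else \<gamma>)) * ?S p q"
    have K: "K_Ib \<gamma> f v (shift \<gamma> l p) $ b $ q = ?c * (1 / (x b + (if b = p then 0 else \<gamma>)) - 1 / v)" for b
      unfolding K_Ib_nth f Lam_shift x_def by (simp add: add.assoc)
    show ?thesis
    proof (cases "b = p")
      case True
      have "BK \<gamma> v (K_Ib \<gamma> f v) l p b q = ?c * (1 / x p - 1 / v) - \<gamma> / (v + \<gamma>) * (?c * (1 / x p - 1 / v))"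
        unfolding BK_def K True using assms(1) by simp
      also have "\<dots> = ?c / x p * (1 - (x p + \<gamma>) / (v + \<gamma>))"
        by (rule BK_fraction_diagonal[OF x0(1) v])
      finally show ?thesis using x0(2)[of p] True by (simp add: right_diff_distrib)
    next
      case False
      have d: "l $ b - l $ p = x p + \<gamma> - (x b + \<gamma>)" unfolding xd[of p b, symmetric] by simp
      have d': "l $ b - l $ p \<noteq> \<gamma>" using assms(2) False unfolding nondegenerate_def by blast
      show ?thesis unfolding BK_def K
        using False BK_fraction[OF x0(2)[of b] x0(1)[of p] v d d', of ?c]
        by (simp add: right_diff_distrib)
    qed
  qed
  show ?thesis
  proof (rule refl_at_factorized[OF assms(1,2) uv, where X = "\<lambda>p. x" and Y = "\<lambda>p q b. 1 / (x b + \<gamma>)"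
        and k = "\<lambda>p q. 1" and d = "\<lambda>p q. \<gamma>" and c = c])
    show "K_Ib \<gamma> f u l $ a $ p * BK \<gamma> v (K_Ib \<gamma> f v) l p b q
        = c p q * ((1 / x a - 1 / u) * (1 / (x b + \<gamma>) - 1 / (v + \<gamma>)))"
      if "v \<noteq> 0" "v + \<gamma> \<noteq> 0" for u v a b p q
      unfolding BK[OF that] K_Ib_nth x_def[symmetric] c_def using x0(1)[of p] by simp
    show "x a \<noteq> 0" "x b - x a = l $ a - l $ b" "\<gamma> \<noteq> 0" "(x a + \<gamma>) * (1 / (x a + \<gamma>)) = 1" for a b
      using x0 xd assms(1) by auto
    fix a b p q
    let ?\<kappa> = "if p = q then 0 else \<gamma> / (l $ p - l $ q)"
    \<comment> \<open>With d = \<gamma> the first term of the exchange condition vanishes and only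
      this relation is left. It holds because the factor \<open>1 + ?\<kappa>\<close> undoes the
      shift in \<open>?S\<close>, making the right-hand side symmetric in p and q.\<close>
    have c: "(1 - ?\<kappa>) * c q p = (1 + ?\<kappa>) * c p q"
    proof (cases "p = q")
      case False
      have S: "(1 + \<gamma> / (l $ p - l $ q)) * ?S p q = ?P q" if "p \<noteq> q" for p q
      proof -
        define L where "L = l $ q - l $ p"
        have L: "L \<noteq> 0" "L - \<gamma> \<noteq> 0" using assms(2) that unfolding nondegenerate_def L_def by auto
        have "?S p q * (\<gamma> / L) = ?P q * (\<gamma> / (L - \<gamma>))"
          unfolding L_def by (rule dprod_shift[OF that])
        then have "(L - \<gamma>) / L * ?S p q = ?P q"
          using L assms(1) by (simp add: divide_simps mult_ac)
        moreover have "1 + \<gamma> / (l $ p - l $ q) = (L - \<gamma>) / L"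
          using L(1) minus_divide_right[of \<gamma> L] by (simp add: L_def diff_divide_distrib)
        ultimately show ?thesis by simp
      qed
      have m: "\<gamma> / (l $ q - l $ p) = - (\<gamma> / (l $ p - l $ q))"
        using minus_divide_right[of \<gamma> "l $ p - l $ q"] by simp
      have "(1 - ?\<kappa>) * c q p = ?P q * ((1 + \<gamma> / (l $ q - l $ p)) * ?S q p) * (x p + \<gamma>) * (x q + \<gamma>)"
        using False unfolding c_def m by simp
      also have "\<dots> = ?P q * ?P p * (x p + \<gamma>) * (x q + \<gamma>)"
        using False by (subst S) auto
      finally have "(1 - ?\<kappa>) * c q p = ?P q * ?P p * (x p + \<gamma>) * (x q + \<gamma>)" .
      moreover have "(1 + ?\<kappa>) * c p q = ?P q * ?P p * (x p + \<gamma>) * (x q + \<gamma>)"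
        using False S[of p q] by (simp add: c_def mult_ac)
      ultimately show ?thesis by simp
    qed simp
    show "(1 - ?\<kappa>) * (c q p * ((1 / x b - 1 / v) * (1 / (x a + \<gamma>) - 1 / (u + \<gamma>))))
      = c p q * ((1 - \<gamma> / \<gamma>) * ((1 / (x b + \<gamma>) - 1 / v) * (1 / x a - 1 / (u + \<gamma>)))
          + (\<gamma> / \<gamma> + ?\<kappa>) * ((1 / x b - 1 / v) * (1 / (x a + \<gamma>) - 1 / (u + \<gamma>))))"
      using c assms(1) by simp
  qed
qed

lemma refl_at_K_IIb:
  fixes f :: "complex^'n::finite \<Rightarrow> complex"
  assumes "\<gamma> \<noteq> 0" "nondegenerate \<gamma> l"
    and uv: "u \<noteq> 0" "v \<noteq> 0" "u + \<gamma> \<noteq> 0" "v + \<gamma> \<noteq> 0" "u \<noteq> v"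
    and f: "\<And>p. f (shift \<gamma> l p) = f l"
    and nz: "\<And>a b. f l - (l $ a - l $ b) \<noteq> 0" "\<And>a b. a \<noteq> b \<Longrightarrow> f l - (l $ a - l $ b) + \<gamma> \<noteq> 0"
      "\<And>a b. a \<noteq> b \<Longrightarrow> f l - (l $ a - l $ b) - \<gamma> \<noteq> 0"
  shows "refl_at \<gamma> (K_IIb f) u v l"
proof -
  define F where "F = f l"
  define X where "X p a = F - (l $ a - l $ p)" for p a
  let ?P = "dprod (\<lambda>x. 1 + F / x) l" and ?S = "\<lambda>p. dprod (\<lambda>x. 1 + F / x) (shift \<gamma> l p)"
  have F0: "F \<noteq> 0" using nz(1)[of undefined undefined] by (simp add: F_def)
  have X0: "X p a \<noteq> 0" for p a using nz(1) unfolding X_def F_def by auto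
  have Xg: "X p a + \<gamma> \<noteq> 0" "X p a - \<gamma> \<noteq> 0" if "a \<noteq> p" for p a
    using nz(2,3)[OF that] unfolding X_def F_def by auto
  \<comment> \<open>For p = q the fraction would be 0 / 0 at b = p when F = -\<gamma>; the value 1
    is therefore set explicitly. For distinct p and q, adding \<open>d p q\<close> turns
    \<open>X p\<close> into \<open>X q\<close>, hence the reciprocal of \<open>X q\<close>.\<close>
  define Y where "Y p q b = (if p = q then if b = p then 1 else (F + \<gamma>) / (X p b + \<gamma>) else 1 / X q b)" for p q b
  define k where "k p q = (if p = q then F + \<gamma> else 1)" for p q :: 'n
  \<comment> \<open>For distinct p and q this makes the second term of the exchange condition
    vanish, instead of the first one as in type Ib.\<close>
  define d where "d p q = (if p = q then \<gamma> else l $ q - l $ p)" for p q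
  \<comment> \<open>The prefactor from \<open>BK_fraction\<close>: the shifted denominator in row p
    is F for p = q and \<open>X q p - \<gamma>\<close> otherwise.\<close>
  define e where "e p q = (if p = q then ?S p p else F * ?S p q * X q p / (X q p - \<gamma>))" for p q
  have BK: "BK \<gamma> v (K_IIb f v) l p b q = e p q * (Y p q b - k p q / (v + \<gamma>))"
    if v: "v \<noteq> 0" "v + \<gamma> \<noteq> 0" for v p b q
  proof -
    let ?s = "shift \<gamma> l p"
    have K: "K_IIb f v ?s $ b $ q = F * ?S p q * (1 / (F - (?s $ b - ?s $ q)) - 1 / v)" for b
      unfolding K_IIb_nth f F_def ..
    have w: "(if p = q then F else X q p - \<gamma>) = F - (?s $ p - ?s $ q)"
      by (auto simp: X_def shift_nth)
    have w0: "F - (?s $ p - ?s $ q) \<noteq> 0" unfolding w[symmetric] using F0 Xg[of p q] by auto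
    have e: "F * ?S p q / (F - (?s $ p - ?s $ q)) = (if p = q then ?S p p else e p q / X q p)"
      unfolding w[symmetric] e_def using F0 X0[of q p] by simp
    have wg: "F - (?s $ p - ?s $ q) + \<gamma> = (if p = q then F + \<gamma> else X q p)"
      unfolding w[symmetric] by simp
    show ?thesis
    proof (cases "b = p")
      case True
      have "BK \<gamma> v (K_IIb f v) l p b q = F * ?S p q / (F - (?s $ p - ?s $ q))
          * (1 - (F - (?s $ p - ?s $ q) + \<gamma>) / (v + \<gamma>))"
        unfolding BK_def K True
        using BK_fraction_diagonal[OF w0 v, of "F * ?S p q"] assms(1) by simp
      also have "\<dots> = e p q * (Y p q b - k p q / (v + \<gamma>))"
        unfolding e wg using True X0[of q p]
        by (auto simp: e_def Y_def k_def divide_simps)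
      finally show ?thesis .
    next
      case False
      have z: "F - (?s $ b - ?s $ q) = (if p = q then X p b + \<gamma> else X q b)"
        using False by (auto simp: X_def shift_nth)
      have z0: "F - (?s $ b - ?s $ q) \<noteq> 0" unfolding z using Xg[OF False] X0 by auto
      have d: "l $ b - l $ p = F - (?s $ p - ?s $ q) + \<gamma> - (F - (?s $ b - ?s $ q))"
        using False by (simp add: shift_nth)
      have d': "l $ b - l $ p \<noteq> \<gamma>" using assms(2) False unfolding nondegenerate_def by blast
      have "BK \<gamma> v (K_IIb f v) l p b q = F * ?S p q / (F - (?s $ p - ?s $ q))
          * ((F - (?s $ p - ?s $ q) + \<gamma>) / (F - (?s $ b - ?s $ q)) - (F - (?s $ p - ?s $ q) + \<gamma>) / (v + \<gamma>))"
        unfolding BK_def K by (rule BK_fraction[OF z0 w0 v d d'])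
      also have "\<dots> = e p q * (Y p q b - k p q / (v + \<gamma>))"
      proof (cases "p = q")
        case True
        then show ?thesis unfolding e wg z using False by (simp add: e_def Y_def k_def)
      next
        case pq: False
        then show ?thesis unfolding e wg z using False X0[of q p]
          by (simp add: Y_def k_def right_diff_distrib)
      qed
      finally show ?thesis .
    qed
  qed
  define c where "c p q = F * ?P p * e p q" for p q
  show ?thesis
  proof (rule refl_at_factorized[OF assms(1,2) uv, where X = X and Y = Y and k = k and d = d and c = c])
    show "K_IIb f u l $ a $ p * BK \<gamma> v (K_IIb f v) l p b q
        = c p q * ((1 / X p a - 1 / u) * (Y p q b - k p q / (v + \<gamma>)))"
      if "v \<noteq> 0" "v + \<gamma> \<noteq> 0" for u v a b p q
      unfolding BK[OF that] K_IIb_nth X_def F_def c_def by simp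
    show "X p a \<noteq> 0" "X p b - X p a = l $ a - l $ b" for p a b
      using X0 by (auto simp: X_def)
    show "d p q \<noteq> 0" for p q
      using assms(1,2) unfolding d_def nondegenerate_def by auto
    show "(X p a + d p q) * Y p q a = k p q" for p q a
    proof -
      have "X p a + (l $ q - l $ p) = X q a" by (simp add: X_def)
      then show ?thesis using Xg(1)[of a p] X0[of q a]
        by (auto simp: d_def Y_def k_def) (simp_all add: X_def)
    qed
    fix a b p q
    show "(1 - (if p = q then 0 else \<gamma> / (l $ p - l $ q))) *
        (c q p * ((1 / X q b - 1 / v) * (Y q p a - k q p / (u + \<gamma>))))
      = c p q * ((1 - \<gamma> / d p q) * ((Y p q b - k p q / v) * (1 / X p a - 1 / (u + \<gamma>)))
          + (\<gamma> / d p q + (if p = q then 0 else \<gamma> / (l $ p - l $ q)))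
            * ((1 / X p b - 1 / v) * (Y p q a - k p q / (u + \<gamma>))))"
    proof (cases "p = q")
      case True
      then show ?thesis using assms(1) by (simp add: d_def)
    next
      case False
      \<comment> \<open>The extra factor \<open>X q p / (X q p - \<gamma>)\<close> in e cancels the
        F-dependent part of the shift of \<open>dprod\<close>, leaving the same factor as in type
        Ib.\<close>
      have S: "(1 + \<gamma> / (l $ p - l $ q)) * e p q = F * ?P q" if "p \<noteq> q" for p q
      proof -
        define L where "L = l $ q - l $ p"
        have L: "L \<noteq> 0" "L - \<gamma> \<noteq> 0" using assms(2) that unfolding nondegenerate_def L_def by auto
        have X: "X q p = F + L" by (simp add: X_def L_def)
        have XL: "F + L \<noteq> 0" "F + L - \<gamma> \<noteq> 0" using X0[of q p] Xg(2)[OF that] unfolding X by auto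
        have "?S p q * (1 + F / L) = ?P q * (1 + F / (L - \<gamma>))"
          unfolding L_def by (rule dprod_shift[OF that])
        then have "?S p q * (F + L) * (L - \<gamma>) = ?P q * (F + L - \<gamma>) * L"
          using L by (simp add: divide_simps split: if_splits) algebra
        define T where "T = ?S p q * (F + L) / (F + L - \<gamma>)"
        have T: "(L - \<gamma>) * T = ?P q * L"
          using \<open>?S p q * (F + L) * (L - \<gamma>) = ?P q * (F + L - \<gamma>) * L\<close> XL
          unfolding T_def by (simp add: nonzero_divide_eq_eq mult_ac)
        have e: "e p q = F * T" unfolding e_def X T_def using that by simp
        have "1 + \<gamma> / (l $ p - l $ q) = (L - \<gamma>) / L"
          using L(1) minus_divide_right[of \<gamma> L] by (simp add: L_def diff_divide_distrib)
        then have "(1 + \<gamma> / (l $ p - l $ q)) * e p q = F * ((L - \<gamma>) * T) / L"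
          unfolding e by simp
        then show ?thesis unfolding T using L(1) by simp
      qed
      have m: "\<gamma> / (l $ q - l $ p) = - (\<gamma> / (l $ p - l $ q))"
        using minus_divide_right[of \<gamma> "l $ p - l $ q"] by simp
      have "(1 - \<gamma> / (l $ p - l $ q)) * c q p = F * ?P q * ((1 + \<gamma> / (l $ q - l $ p)) * e q p)"
        unfolding c_def m by algebra
      also have "\<dots> = F * ?P p * ((1 + \<gamma> / (l $ p - l $ q)) * e p q)"
        using False by (subst (1 2) S) auto
      also have "\<dots> = (1 + \<gamma> / (l $ p - l $ q)) * c p q" unfolding c_def by algebra
      finally have c: "(1 - \<gamma> / (l $ p - l $ q)) * c q p = (1 + \<gamma> / (l $ p - l $ q)) * c p q" .
      have Y: "Y q p a = 1 / X p a" "Y p q b = 1 / X q b" "k p q = 1" "k q p = 1" "d p q = l $ q - l $ p"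
        using False by (auto simp: Y_def k_def d_def)
      have "(1 - \<gamma> / (l $ p - l $ q)) * (c q p * ((1 / X q b - 1 / v) * (1 / X p a - 1 / (u + \<gamma>))))
        = c p q * ((1 + \<gamma> / (l $ p - l $ q)) * ((1 / X q b - 1 / v) * (1 / X p a - 1 / (u + \<gamma>))))"
        using c by algebra
      then show ?thesis unfolding Y m using False by simp
    qed
  qed
qed

section \<open>Existence and uniqueness in types Ib and IIb\<close>

lemma generic_not_zero:
  fixes F :: "complex^'n::finite \<Rightarrow> complex"
  assumes "meromorphic_Cn F" "\<not> generic (\<lambda>l. F l = 0)"
  shows "generic (\<lambda>l. F l \<noteq> 0)"
  using meromorphic_Cn_dichotomy assms by blast

lemma not_generic_zero:
  assumes "generic (\<lambda>l. F l \<noteq> 0)"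
  shows "\<not> generic (\<lambda>l. F l = 0)"
proof
  assume "generic (\<lambda>l. F l = 0)"
  from generic_exists[OF generic_conj[OF assms this]] show False by blast
qed

lemma reflection_eqI:
  fixes K :: "complex \<Rightarrow> complex^'n::finite \<Rightarrow> complex^'n^'n"
  assumes "generic P"
    and "\<And>u v l. P l \<Longrightarrow> u \<noteq> 0 \<Longrightarrow> v \<noteq> 0 \<Longrightarrow> u + \<gamma> \<noteq> 0 \<Longrightarrow> v + \<gamma> \<noteq> 0 \<Longrightarrow> u \<noteq> v \<Longrightarrow> refl_at \<gamma> K u v l"
  shows "reflection_eq \<gamma> K"
proof -
  have "generic (\<lambda>(u::complex, v::complex, l). P l)"
    using generic_snd[OF generic_snd[OF assms(1)]] by simp
  from generic_conj[OF this generic_spectral[of \<gamma>]] show ?thesis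
    unfolding generic_refl_at_iff by (rule generic_mono) (use assms(2) in auto)
qed

text \<open>Multiplying by y (y + \<gamma>) gives (C - s y) G = C \<mu> (y + \<gamma>), affine in y
  on both sides. Agreement at two points forces -s G = C \<mu> and G = \<mu> \<gamma>; eliminating
  \<mu> gives s.\<close>

lemma column_constant_unique:
  fixes C G s y y' \<gamma> \<mu> :: complex
  assumes "C \<noteq> 0" "G \<noteq> 0" "\<gamma> \<noteq> 0" "y \<noteq> 0" "y' \<noteq> 0" "y + \<gamma> \<noteq> 0" "y' + \<gamma> \<noteq> 0" "y \<noteq> y'"
    and "(C / y - s) * (G / (y + \<gamma>)) = C / y * \<mu>"
    and "(C / y' - s) * (G / (y' + \<gamma>)) = C / y' * \<mu>"
  shows "s = - (C / \<gamma>)"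
proof -
  have e: "(C - s * z) * G = C * \<mu> * (z + \<gamma>)"
    if "z \<noteq> 0" "z + \<gamma> \<noteq> 0" "(C / z - s) * (G / (z + \<gamma>)) = C / z * \<mu>" for z
  proof -
    have "C / z - s = (C - s * z) / z" using that(1) by (simp add: divide_simps)
    then show ?thesis using that by (simp add: divide_simps)
  qed
  note e = e[OF assms(4,6,9)] e[OF assms(5,7,10)]
  have "(y - y') * (s * G + C * \<mu>) = 0" using e by algebra
  then have "C * \<mu> = - (s * G)" using assms(8) by (simp add: eq_neg_iff_add_eq_0 add.commute)
  then have "G * (C + s * \<gamma>) = 0" using e(1) by algebra
  then have "C = - s * \<gamma>" using assms(2) by (simp add: eq_neg_iff_add_eq_0)
  then show ?thesis using assms(3) by simp
qed

lemma obtain_other_index: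
  assumes "CARD('n::finite) \<ge> 2"
  obtains q where "q \<noteq> (p::'n)"
proof -
  have "(UNIV :: 'n set) \<noteq> {p}"
  proof
    assume "(UNIV :: 'n set) = {p}"
    then have "CARD('n) = card {p}" by (rule arg_cong)
    then show False using assms by simp
  qed
  then show ?thesis using that by blast
qed

lemma generic_mat_eqI:
  fixes k k' :: "complex^'n::finite \<Rightarrow> complex^'n^'n"
  assumes "\<And>i j. generic (\<lambda>l. k l $ i $ j = k' l $ i $ j)"
  shows "generic (\<lambda>l. k l = k' l)"
proof -
  have "generic (\<lambda>l. \<forall>i j. k l $ i $ j = k' l $ i $ j)" using assms by (intro generic_all)
  then show ?thesis by (simp add: vec_eq_iff)
qed

lemma no_zero_columnI:
  assumes "\<And>i j. generic (\<lambda>l. k l $ i $ j \<noteq> 0)"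
  shows "no_zero_column k"
  unfolding no_zero_column_def
proof
  fix j
  show "\<not> generic (\<lambda>l. column j (k l) = 0)"
  proof
    assume "generic (\<lambda>l. column j (k l) = 0)"
    then have "generic (\<lambda>l. k l $ j $ j = 0)"
      by (rule generic_mono) (simp add: column_def vec_eq_iff)
    then show False using not_generic_zero[OF assms] by blast
  qed
qed

text \<open>Read off as the coefficient of \<gamma> / u in \<open>K_Ib\<close>; it does not depend
  on the row, as the necessary condition demands.\<close>

definition k1_Ib :: "complex \<Rightarrow> (complex^'n::finite \<Rightarrow> complex) \<Rightarrow> complex^'n \<Rightarrow> complex^'n^'n" where
  "k1_Ib \<gamma> f l = (\<chi> i j. - ((f l + Lam l j) * dprod (\<lambda>x. \<gamma> / x) l j / \<gamma>))"

lemma K_ansatz_k1_Ib: "\<gamma> \<noteq> 0 \<Longrightarrow> K_ansatz \<gamma> (k0_Ib \<gamma> f) (k1_Ib \<gamma> f) = K_Ib \<gamma> f"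
  by (simp add: fun_eq_iff vec_eq_iff K_ansatz_def mscale_def k0_Ib_def k1_Ib_def K_Ib_def dprod_def
      right_diff_distrib left_diff_distrib mult.commute)

lemma dprod_gamma_nonzero:
  assumes "\<gamma> \<noteq> 0" "nondegenerate \<gamma> l"
  shows "dprod (\<lambda>x. \<gamma> / x) l p \<noteq> 0" "dprod (\<lambda>x. \<gamma> / x) (shift \<gamma> l p) p \<noteq> 0"
proof -
  show "dprod (\<lambda>x. \<gamma> / x) l p \<noteq> 0"
    using assms unfolding nondegenerate_def by (intro dprod_nonzero) auto
  show "dprod (\<lambda>x. \<gamma> / x) (shift \<gamma> l p) p \<noteq> 0"
    using assms(1) nondegenerate_shift_diff[OF assms(2)] by (intro dprod_nonzero) auto
qed

lemma k0_Ib_nth: "k0_Ib \<gamma> f l $ i $ j = (f l + Lam l j) / (f l + Lam l i) * dprod (\<lambda>x. \<gamma> / x) l j"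
  by (simp add: k0_Ib_def dprod_def)

lemma type_Ib:
  fixes f :: "complex^'n::finite \<Rightarrow> complex"
  assumes card: "CARD('n) \<ge> 2" and \<gamma>: "\<gamma> \<noteq> 0" and mero: "meromorphic_Cn f"
    and per: "\<forall>i. generic (\<lambda>l. f (shift \<gamma> l i) = f l)" and nze: "no_zero_entry (k0_Ib \<gamma> f)"
  shows "solves_with \<gamma> (k0_Ib \<gamma> f) (k1_Ib \<gamma> f)"
    and "solves_with \<gamma> (k0_Ib \<gamma> f) k1' \<Longrightarrow> generic (\<lambda>l. k1' l = k1_Ib \<gamma> f l)"
    and "no_zero_column (k1_Ib \<gamma> f)"
proof -
  have x0: "generic (\<lambda>l. f l + Lam l i \<noteq> 0)" for i
  proof (rule generic_not_zero)
    show "meromorphic_Cn (\<lambda>l. f l + Lam l i)"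
      by (intro meromorphic_Cn_add mero meromorphic_Cn_Lam)
    show "\<not> generic (\<lambda>l. f l + Lam l i = 0)"
    proof
      assume "generic (\<lambda>l. f l + Lam l i = 0)"
      \<comment> \<open>Division by zero yields 0, so an identically vanishing denominator would
        give a zero diagonal entry.\<close>
      then have "generic (\<lambda>l. k0_Ib \<gamma> f l $ i $ i = 0)"
        by (rule generic_mono) (simp add: k0_Ib_def)
      then show False using nze unfolding no_zero_entry_def by blast
    qed
  qed
  have per': "generic (\<lambda>l. \<forall>i. f (shift \<gamma> l i) = f l)" using per by (intro generic_all) blast
  have xg: "generic (\<lambda>l. f l + Lam l i + \<gamma> \<noteq> 0)" for i
  proof -
    \<comment> \<open>\<open>Lam l i\<close> grows by \<gamma> only under a shift in another
      direction, which exists because n is at least 2.\<close>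
    obtain p where p: "p \<noteq> i" using obtain_other_index[OF card] by blast
    show ?thesis
      by (rule generic_mono[OF generic_conj[OF generic_shift[OF x0[of i], of \<gamma> p] per']])
        (use p in \<open>auto simp: Lam_shift add.assoc\<close>)
  qed
  let ?R = "\<lambda>l. nondegenerate \<gamma> l \<and> (\<forall>p. f (shift \<gamma> l p) = f l)
    \<and> (\<forall>a. f l + Lam l a \<noteq> 0) \<and> (\<forall>a. f l + Lam l a + \<gamma> \<noteq> 0)"
  have R: "generic ?R"
    by (intro generic_conj generic_nondegenerate per' generic_all x0 xg)
  have k0: "generic (\<lambda>l. k0_Ib \<gamma> f l $ i $ j \<noteq> 0)" for i j
    by (rule generic_mono[OF R]) (simp add: k0_Ib_nth dprod_gamma_nonzero[OF \<gamma>])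
  have "meromorphic_mat (k1_Ib \<gamma> f)"
  proof -
    have "meromorphic_Cn (\<lambda>l. - ((f l + Lam l j) * dprod (\<lambda>x. \<gamma> / x) l j * (1 / \<gamma>)))" for j
      unfolding dprod_def
      by (intro meromorphic_Cn_uminus meromorphic_Cn_mult meromorphic_Cn_add mero meromorphic_Cn_Lam
          meromorphic_Cn_prod meromorphic_Cn_const meromorphic_Cn_inverse_diff) auto
    then show ?thesis by (simp add: meromorphic_mat_def k1_Ib_def)
  qed
  moreover have "reflection_eq \<gamma> (K_Ib \<gamma> f)"
    by (rule reflection_eqI[OF R], rule refl_at_K_Ib[OF \<gamma>]) auto
  ultimately show "solves_with \<gamma> (k0_Ib \<gamma> f) (k1_Ib \<gamma> f)"
    unfolding solves_with_def K_ansatz_k1_Ib[OF \<gamma>] by blast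
  show "no_zero_column (k1_Ib \<gamma> f)"
    by (rule no_zero_columnI, rule generic_mono[OF R])
      (simp add: k1_Ib_def \<gamma> dprod_gamma_nonzero[OF \<gamma>])
  assume "solves_with \<gamma> (k0_Ib \<gamma> f) k1'"
  then have nec: "generic (\<lambda>l. \<forall>a p. k1' l $ a $ p = k1' l $ p $ p \<and>
      (k0_Ib \<gamma> f l $ a $ p - k1' l $ a $ p) * BK0 \<gamma> (k0_Ib \<gamma> f) l p a
      = k0_Ib \<gamma> f l $ a $ p * (k0_Ib \<gamma> f (shift \<gamma> l p) $ p $ p - k1' (shift \<gamma> l p) $ p $ p))"
    unfolding solves_with_def by (intro reflection_ansatz_necessary[OF \<gamma> _ k0]) auto
  show "generic (\<lambda>l. k1' l = k1_Ib \<gamma> f l)"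
  proof (rule generic_mat_eqI, rule generic_mono[OF generic_conj[OF R nec]])
    fix i p :: 'n and l
    assume l: "?R l \<and> (\<forall>a p. k1' l $ a $ p = k1' l $ p $ p \<and>
      (k0_Ib \<gamma> f l $ a $ p - k1' l $ a $ p) * BK0 \<gamma> (k0_Ib \<gamma> f) l p a
      = k0_Ib \<gamma> f l $ a $ p * (k0_Ib \<gamma> f (shift \<gamma> l p) $ p $ p - k1' (shift \<gamma> l p) $ p $ p))"
    define x where "x a = f l + Lam l a" for a
    let ?P = "dprod (\<lambda>x. \<gamma> / x) l p" and ?S = "dprod (\<lambda>x. \<gamma> / x) (shift \<gamma> l p) p"
    have x: "x a \<noteq> 0" "x a + \<gamma> \<noteq> 0" for a using l unfolding x_def by auto
    have xd: "x b - x a = l $ a - l $ b" for a b unfolding x_def using Lam_diff[of l b a] by simp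
    have nd: "nondegenerate \<gamma> l" using l by blast
    have k: "k0_Ib \<gamma> f l $ a $ p = x p * ?P / x a" for a
      by (simp add: k0_Ib_def dprod_def x_def)
    have ks: "k0_Ib \<gamma> f (shift \<gamma> l p) $ a $ p = x p * ?S / (x a + (if a = p then 0 else \<gamma>))" for a
      using l by (simp add: k0_Ib_def dprod_def x_def Lam_shift add.assoc)
    have g: "BK0 \<gamma> (k0_Ib \<gamma> f) l p a = ?S * (x p + \<gamma>) / (x a + \<gamma>)" for a
    proof (cases "a = p")
      case True
      then show ?thesis using x[of p] \<gamma> unfolding BK0_def ks by simp
    next
      case False
      have d: "l $ a - l $ p = x p + \<gamma> - (x a + \<gamma>)" unfolding xd[of p a, symmetric] by simp
      have d': "l $ a - l $ p \<noteq> \<gamma>" using nd False unfolding nondegenerate_def by blast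
      show ?thesis unfolding BK0_def ks
        using False BK0_fraction[OF x(2)[of a] x(1)[of p] d d', of "x p * ?S"] x(1)[of p] by simp
    qed
    obtain q where q: "q \<noteq> p" using obtain_other_index[OF card] by blast
    let ?\<mu> = "k0_Ib \<gamma> f (shift \<gamma> l p) $ p $ p - k1' (shift \<gamma> l p) $ p $ p"
    have col: "k1' l $ a $ p = k1' l $ p $ p" for a using l by blast
    have eq: "(x p * ?P / x a - k1' l $ p $ p) * (?S * (x p + \<gamma>) / (x a + \<gamma>)) = x p * ?P / x a * ?\<mu>" for a
      using l[THEN conjunct2, THEN spec[of _ a], THEN spec[of _ p], THEN conjunct2] unfolding col[of a] k g .
    have "x p \<noteq> x q" using xd[of p q] nd q unfolding nondegenerate_def by force
    then have "k1' l $ p $ p = - (x p * ?P / \<gamma>)"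
      using x \<gamma> dprod_gamma_nonzero[OF \<gamma> nd]
      by (intro column_constant_unique[OF _ _ _ _ _ _ _ _ eq eq, of p q]) auto
    then show "k1' l $ i $ p = k1_Ib \<gamma> f l $ i $ p"
      using col[of i] by (simp add: k1_Ib_def x_def)
  qed
qed

definition k1_IIb :: "complex \<Rightarrow> (complex^'n::finite \<Rightarrow> complex) \<Rightarrow> complex^'n \<Rightarrow> complex^'n^'n" where
  "k1_IIb \<gamma> f l = (\<chi> i j. - (f l * dprod (\<lambda>x. 1 + f l / x) l j / \<gamma>))"

lemma K_ansatz_k1_IIb: "\<gamma> \<noteq> 0 \<Longrightarrow> K_ansatz \<gamma> (k0_IIb f) (k1_IIb \<gamma> f) = K_IIb f"
  by (simp add: fun_eq_iff vec_eq_iff K_ansatz_def mscale_def k0_IIb_def k1_IIb_def K_IIb_def dprod_def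
      right_diff_distrib left_diff_distrib mult.commute)

lemma type_IIb:
  fixes f :: "complex^'n::finite \<Rightarrow> complex"
  assumes card: "CARD('n) \<ge> 2" and \<gamma>: "\<gamma> \<noteq> 0" and mero: "meromorphic_Cn f"
    and per: "\<forall>i. generic (\<lambda>l. f (shift \<gamma> l i) = f l)" and nze: "no_zero_entry (k0_IIb f)"
  shows "solves_with \<gamma> (k0_IIb f) (k1_IIb \<gamma> f)"
    and "solves_with \<gamma> (k0_IIb f) k1' \<Longrightarrow> generic (\<lambda>l. k1' l = k1_IIb \<gamma> f l)"
    and "no_zero_column (k1_IIb \<gamma> f)"
proof -
  have x0: "generic (\<lambda>l. f l - (l $ i - l $ j) \<noteq> 0)" for i j
  proof (rule generic_not_zero)
    show "meromorphic_Cn (\<lambda>l. f l - (l $ i - l $ j))"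
      by (intro meromorphic_Cn_diff mero meromorphic_Cn_component)
    show "\<not> generic (\<lambda>l. f l - (l $ i - l $ j) = 0)"
    proof
      assume "generic (\<lambda>l. f l - (l $ i - l $ j) = 0)"
      \<comment> \<open>Again by the convention for division by zero. The case i = j shows in
        addition that f is generically nonzero.\<close>
      then have "generic (\<lambda>l. k0_IIb f l $ i $ j = 0)"
        by (rule generic_mono) (simp add: k0_IIb_def)
      then show False using nze unfolding no_zero_entry_def by blast
    qed
  qed
  have x0': "generic (\<lambda>l. \<forall>i j. f l - (l $ i - l $ j) \<noteq> 0)" by (intro generic_all x0)
  have per': "generic (\<lambda>l. \<forall>i. f (shift \<gamma> l i) = f l)" using per by (intro generic_all) blast
  have xg: "generic (\<lambda>l. i \<noteq> j \<longrightarrow> f l - (l $ i - l $ j) + \<gamma> \<noteq> 0)" for i j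
    by (rule generic_mono[OF generic_conj[OF generic_shift[OF x0[of i j], of \<gamma> j] per']])
      (auto simp: shift_nth algebra_simps)
  have xg': "generic (\<lambda>l. i \<noteq> j \<longrightarrow> f l - (l $ i - l $ j) - \<gamma> \<noteq> 0)" for i j
    by (rule generic_mono[OF generic_conj[OF generic_shift[OF x0[of i j], of \<gamma> i] per']])
      (auto simp: shift_nth algebra_simps)
  let ?R = "\<lambda>l. nondegenerate \<gamma> l \<and> (\<forall>p. f (shift \<gamma> l p) = f l)
    \<and> (\<forall>i j. f l - (l $ i - l $ j) \<noteq> 0)
    \<and> (\<forall>i j. i \<noteq> j \<longrightarrow> f l - (l $ i - l $ j) + \<gamma> \<noteq> 0)
    \<and> (\<forall>i j. i \<noteq> j \<longrightarrow> f l - (l $ i - l $ j) - \<gamma> \<noteq> 0)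
    \<and> (\<forall>p i j. f (shift \<gamma> l p) - (shift \<gamma> l p $ i - shift \<gamma> l p $ j) \<noteq> 0)"
  have R: "generic ?R"
    by (intro generic_conj generic_nondegenerate per' x0' generic_all xg xg' generic_shift[OF x0])
  have RD: "nondegenerate \<gamma> l" "f (shift \<gamma> l p) = f l" "f l - (l $ i - l $ j) \<noteq> 0"
    "i \<noteq> j \<Longrightarrow> f l - (l $ i - l $ j) + \<gamma> \<noteq> 0"
    "f l - (shift \<gamma> l p $ i - shift \<gamma> l p $ j) \<noteq> 0" if "?R l" for l p i j
  proof -
    have 1: "nondegenerate \<gamma> l" using that by (elim conjE)
    have 2: "\<forall>p. f (shift \<gamma> l p) = f l" using that by (elim conjE)
    have 3: "\<forall>i j. f l - (l $ i - l $ j) \<noteq> 0" using that by (elim conjE)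
    have 4: "\<forall>i j. i \<noteq> j \<longrightarrow> f l - (l $ i - l $ j) + \<gamma> \<noteq> 0" using that by (elim conjE)
    have 5: "\<forall>p i j. f (shift \<gamma> l p) - (shift \<gamma> l p $ i - shift \<gamma> l p $ j) \<noteq> 0"
      using that by (elim conjE)
    show "nondegenerate \<gamma> l" by (rule 1)
    show "f (shift \<gamma> l p) = f l" by (rule 2[rule_format])
    show "f l - (l $ i - l $ j) \<noteq> 0" by (rule 3[rule_format])
    show "f l - (l $ i - l $ j) + \<gamma> \<noteq> 0" if "i \<noteq> j" by (rule 4[rule_format, OF that])
    show "f l - (shift \<gamma> l p $ i - shift \<gamma> l p $ j) \<noteq> 0"
      using 5[rule_format, of p i j] 2[rule_format, of p] by simp
  qed
  have f0: "f l \<noteq> 0" if "?R l" for l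
    using RD(3)[OF that, of undefined undefined] by simp
  have Q0: "dprod (\<lambda>x. 1 + f l / x) l p \<noteq> 0" "dprod (\<lambda>x. 1 + f l / x) (shift \<gamma> l p) p \<noteq> 0"
    if l: "?R l" for l p
  proof -
    have *: "1 + f l / (m $ p - m $ a) \<noteq> 0"
      if "m $ p - m $ a \<noteq> 0" "f l - (m $ a - m $ p) \<noteq> 0" for m :: "complex^'n" and a
      using that by (simp add: divide_simps algebra_simps split: if_splits)
    show "dprod (\<lambda>x. 1 + f l / x) l p \<noteq> 0"
      using RD(1)[OF l] RD(3)[OF l] unfolding nondegenerate_def by (intro dprod_nonzero *) metis+
    show "dprod (\<lambda>x. 1 + f l / x) (shift \<gamma> l p) p \<noteq> 0"
      by (intro dprod_nonzero * nondegenerate_shift_diff RD(1,5) l)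
  qed
  have k0: "generic (\<lambda>l. k0_IIb f l $ i $ j \<noteq> 0)" for i j
  proof (rule generic_mono[OF R])
    fix l assume l: "?R l"
    from RD(3)[OF this] have "f l - (l $ i - l $ j) \<noteq> 0" .
    then show "k0_IIb f l $ i $ j \<noteq> 0" using f0[OF l] Q0(1)[OF l, of j] by (simp add: k0_IIb_def dprod_def)
  qed
  have "meromorphic_mat (k1_IIb \<gamma> f)"
  proof -
    have "meromorphic_Cn (\<lambda>l. - (f l * (\<Prod>a\<in>UNIV - {j}. 1 + f l * (1 / (l $ j - l $ a))) * (1 / \<gamma>)))" for j
      by (intro meromorphic_Cn_uminus meromorphic_Cn_mult meromorphic_Cn_add mero
          meromorphic_Cn_prod meromorphic_Cn_const meromorphic_Cn_inverse_diff) auto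
    then show ?thesis by (simp add: meromorphic_mat_def k1_IIb_def dprod_def)
  qed
  moreover have "reflection_eq \<gamma> (K_IIb f)"
    by (rule reflection_eqI[OF R], rule refl_at_K_IIb[OF \<gamma>]) auto
  ultimately show "solves_with \<gamma> (k0_IIb f) (k1_IIb \<gamma> f)"
    unfolding solves_with_def K_ansatz_k1_IIb[OF \<gamma>] by blast
  show "no_zero_column (k1_IIb \<gamma> f)"
  proof (rule no_zero_columnI, rule generic_mono[OF R])
    fix i j l assume l: "?R l"
    show "k1_IIb \<gamma> f l $ i $ j \<noteq> 0"
      using f0[OF l] Q0(1)[OF l, of j] \<gamma> by (simp add: k1_IIb_def)
  qed
  assume "solves_with \<gamma> (k0_IIb f) k1'"
  then have nec: "generic (\<lambda>l. \<forall>a p. k1' l $ a $ p = k1' l $ p $ p \<and>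
      (k0_IIb f l $ a $ p - k1' l $ a $ p) * BK0 \<gamma> (k0_IIb f) l p a
      = k0_IIb f l $ a $ p * (k0_IIb f (shift \<gamma> l p) $ p $ p - k1' (shift \<gamma> l p) $ p $ p))"
    (is "generic ?N")
    unfolding solves_with_def by (intro reflection_ansatz_necessary[OF \<gamma> _ k0]) auto
  have key: "k1' l $ a $ p = k1' l $ p $ p \<and>
      (f l + \<gamma> \<noteq> 0 \<longrightarrow> k1' l $ p $ p = - (f l * dprod (\<lambda>x. 1 + f l / x) l p / \<gamma>)) \<and>
      (f l + \<gamma> = 0 \<longrightarrow> k1' (shift \<gamma> l p) $ p $ p = k0_IIb f (shift \<gamma> l p) $ p $ p)"
    if R: "?R l" and N: "?N l" for l a p
  proof -
    define F where "F = f l"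
    define x where "x a = F - (l $ a - l $ p)" for a
    let ?P = "dprod (\<lambda>x. 1 + F / x) l p" and ?S = "dprod (\<lambda>x. 1 + F / x) (shift \<gamma> l p) p"
    have F: "F \<noteq> 0" "x p = F" using f0[OF R] unfolding x_def F_def by auto
    have x: "x a \<noteq> 0" for a unfolding x_def F_def by (rule RD(3)[OF R])
    have xg: "x a + \<gamma> \<noteq> 0" if "a \<noteq> p" for a unfolding x_def F_def by (rule RD(4)[OF R that])
    have nd: "nondegenerate \<gamma> l" by (rule RD(1)[OF R])
    have k: "k0_IIb f l $ a $ p = F * ?P / x a" for a
      by (simp add: k0_IIb_def dprod_def x_def F_def)
    have ks: "k0_IIb f (shift \<gamma> l p) $ a $ p = F * ?S / (x a + (if a = p then 0 else \<gamma>))" for a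
    proof -
      have "f (shift \<gamma> l p) = F" unfolding F_def by (rule RD(2)[OF R])
      then show ?thesis by (simp add: k0_IIb_def dprod_def x_def shift_nth algebra_simps)
    qed
    \<comment> \<open>Row p is kept separate: the general expression there would have denominator F
      + \<gamma>, which is zero for f = -\<gamma>.\<close>
    have g: "BK0 \<gamma> (k0_IIb f) l p a = (if a = p then ?S else ?S * (F + \<gamma>) / (x a + \<gamma>))" for a
    proof (cases "a = p")
      case True
      then show ?thesis using F \<gamma> unfolding BK0_def ks by simp
    next
      case False
      have d: "l $ a - l $ p = F + \<gamma> - (x a + \<gamma>)" by (simp add: x_def)
      have d': "l $ a - l $ p \<noteq> \<gamma>" using nd False unfolding nondegenerate_def by blast
      show ?thesis unfolding BK0_def ks
        using False BK0_fraction[OF xg[OF False] F(1) d d', of "F * ?S"] F by simp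
    qed
    obtain q where q: "q \<noteq> p" using obtain_other_index[OF card] by blast
    let ?\<mu> = "k0_IIb f (shift \<gamma> l p) $ p $ p - k1' (shift \<gamma> l p) $ p $ p"
    have col: "k1' l $ a $ p = k1' l $ p $ p" for a
      by (rule N[THEN spec[of _ a], THEN spec[of _ p], THEN conjunct1])
    have eq: "(F * ?P / x a - k1' l $ p $ p) * (if a = p then ?S else ?S * (F + \<gamma>) / (x a + \<gamma>))
        = F * ?P / x a * ?\<mu>" for a
      using N[THEN spec[of _ a], THEN spec[of _ p], THEN conjunct2] unfolding col[of a] k g .
    have nz: "?P \<noteq> 0" "?S \<noteq> 0" using Q0[OF R] unfolding F_def by auto
    have "x p \<noteq> x q" using nd q unfolding nondegenerate_def x_def by force
    \<comment> \<open>Since \<open>x p\<close> is F, row p also has the form required by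
      \<open>column_constant_unique\<close>, with G equal to
      \<open>?S * (F + \<gamma>)\<close>.\<close>
    then have "k1' l $ p $ p = - (F * ?P / \<gamma>)" if "F + \<gamma> \<noteq> 0"
      using eq[of p] eq[of q] x[of p] x[of q] xg[OF q] \<gamma> nz that F q
      by (intro column_constant_unique[of "F * ?P" "?S * (F + \<gamma>)" \<gamma> "x p" "x q" _ ?\<mu>]) auto
    \<comment> \<open>For F = -\<gamma> the left-hand side vanishes in every row other than p, so
      the relation constrains only the shifted entry.\<close>
    moreover have "?\<mu> = 0" if "F + \<gamma> = 0"
      using eq[of q] that q F(1) nz(1) x[of q] by simp
    ultimately show ?thesis using col unfolding F_def by auto
  qed
  have "meromorphic_Cn (\<lambda>l. f l + \<gamma>)" by (intro meromorphic_Cn_add mero meromorphic_Cn_const)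
  then consider (nz) "generic (\<lambda>l. f l + \<gamma> \<noteq> 0)" | (z) "generic (\<lambda>l. f l + \<gamma> = 0)"
    using meromorphic_Cn_dichotomy by blast
  then show "generic (\<lambda>l. k1' l = k1_IIb \<gamma> f l)"
  proof cases
    case nz
    show ?thesis
    proof (rule generic_mat_eqI, rule generic_mono[OF generic_conj[OF nz generic_conj[OF R nec]]])
      fix i j l assume l: "f l + \<gamma> \<noteq> 0 \<and> ?R l \<and> ?N l"
      from key[OF l[THEN conjunct2, THEN conjunct1] l[THEN conjunct2, THEN conjunct2], of i j]
      show "k1' l $ i $ j = k1_IIb \<gamma> f l $ i $ j"
        using l[THEN conjunct1] by (simp add: k1_IIb_def)
    qed
  next
    case z
    \<comment> \<open>For \<open>f = -\<gamma>\<close> the rows \<open>a \<noteq> p\<close> only determine \<open>k\<^sub>1\<close> at the shifted point.\<close>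
    have s: "generic (\<lambda>l. k1' l $ p $ p = k0_IIb f l $ p $ p)" for p
    proof (rule generic_unshift[of _ \<gamma> p], rule generic_mono[OF generic_conj[OF z generic_conj[OF R nec]]])
      fix l assume l: "f l + \<gamma> = 0 \<and> ?R l \<and> ?N l"
      from key[OF l[THEN conjunct2, THEN conjunct1] l[THEN conjunct2, THEN conjunct2], of p p]
      show "k1' (shift \<gamma> l p) $ p $ p = k0_IIb f (shift \<gamma> l p) $ p $ p"
        using l[THEN conjunct1] by simp
    qed
    show ?thesis
    proof (rule generic_mat_eqI, rule generic_mono[OF generic_conj[OF s generic_conj[OF z generic_conj[OF R nec]]]])
      fix i j l assume l: "k1' l $ j $ j = k0_IIb f l $ j $ j \<and> f l + \<gamma> = 0 \<and> ?R l \<and> ?N l"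
      note R = l[THEN conjunct2, THEN conjunct2, THEN conjunct1]
      \<comment> \<open>For this f the claimed constant is the bare product, which is also the
        diagonal entry of \<open>k0_IIb\<close>; the two descriptions of \<open>k1\<close>
        agree.\<close>
      have "f l = - \<gamma>" using l[THEN conjunct2, THEN conjunct1] by (simp add: eq_neg_iff_add_eq_0)
      then have f\<gamma>: "f l / \<gamma> = - 1" using \<gamma> by simp
      have "k1_IIb \<gamma> f l $ i $ j = - (f l / \<gamma>) * dprod (\<lambda>x. 1 + f l / x) l j"
        by (simp add: k1_IIb_def)
      then have "k1_IIb \<gamma> f l $ i $ j = dprod (\<lambda>x. 1 + f l / x) l j"
        unfolding f\<gamma> by simp
      moreover have "k0_IIb f l $ j $ j = dprod (\<lambda>x. 1 + f l / x) l j"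
        using f0[OF R] by (simp add: k0_IIb_def dprod_def)
      ultimately show "k1' l $ i $ j = k1_IIb \<gamma> f l $ i $ j"
        using key[OF R l[THEN conjunct2, THEN conjunct2, THEN conjunct2], of i j] l[THEN conjunct1]
        by simp
    qed
  qed
qed

section \<open>Nonexistence in types Ia and IIa\<close>

text \<open>The relation makes every \<open>y a\<close> a root of one polynomial of degree 2 with
  leading coefficient C c. Injectivity of y then bounds n by 2, whatever s and \<mu> are.\<close>

lemma linear_column_contradiction:
  fixes y :: "'n::finite \<Rightarrow> complex"
  assumes "CARD('n) \<ge> 3" "inj y" "C \<noteq> 0" "c \<noteq> 0"
    and "\<And>a. (C * y a - s) * (c * (y a + \<gamma>)) = C * y a * \<mu>"
  shows False
proof -
  let ?p = "[:- s * c * \<gamma>, C * c * \<gamma> - s * c - C * \<mu>, C * c:]"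
  have "range y \<subseteq> {z. poly ?p z = 0}"
    using assms(5) by (auto simp: algebra_simps)
  moreover have p: "?p \<noteq> 0" using assms(3,4) by simp
  ultimately have "card (range y) \<le> card {z. poly ?p z = 0}"
    by (intro card_mono poly_roots_finite)
  also have "\<dots> \<le> degree ?p" by (rule card_poly_roots_bound[OF p])
  also have "\<dots> \<le> 2" by simp
  finally show False using assms(1) card_image[OF assms(2)] by simp
qed

lemma k0_Ia_nth: "k0_Ia \<gamma> f l $ i $ j = (f l + l $ i) / (f l + l $ j) * dprod (\<lambda>x. \<gamma> / x) l j"
  by (simp add: k0_Ia_def dprod_def)

lemma type_Ia:
  fixes f :: "complex^'n::finite \<Rightarrow> complex"
  assumes card: "CARD('n) \<ge> 3" and \<gamma>: "\<gamma> \<noteq> 0" and mero: "meromorphic_Cn f"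
    and per: "\<forall>i. generic (\<lambda>l. f (shift \<gamma> l i) = f l)" and nze: "no_zero_entry (k0_Ia \<gamma> f)"
  shows "\<not> solves_with \<gamma> (k0_Ia \<gamma> f) k1"
proof
  assume sol: "solves_with \<gamma> (k0_Ia \<gamma> f) k1"
  have y0: "generic (\<lambda>l. f l + l $ i \<noteq> 0)" for i
  proof (rule generic_not_zero)
    show "meromorphic_Cn (\<lambda>l. f l + l $ i)"
      by (intro meromorphic_Cn_add mero meromorphic_Cn_component)
    show "\<not> generic (\<lambda>l. f l + l $ i = 0)"
    proof
      assume "generic (\<lambda>l. f l + l $ i = 0)"
      then have "generic (\<lambda>l. k0_Ia \<gamma> f l $ i $ i = 0)"
        by (rule generic_mono) (simp add: k0_Ia_def)
      then show False using nze unfolding no_zero_entry_def by blast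
    qed
  qed
  have per': "generic (\<lambda>l. \<forall>i. f (shift \<gamma> l i) = f l)" using per by (intro generic_all) blast
  let ?R = "\<lambda>l. nondegenerate \<gamma> l \<and> (\<forall>p. f (shift \<gamma> l p) = f l) \<and> (\<forall>i. f l + l $ i \<noteq> 0)
    \<and> (\<forall>p i. f (shift \<gamma> l p) + shift \<gamma> l p $ i \<noteq> 0)"
  have R: "generic ?R"
    by (intro generic_conj generic_nondegenerate per' generic_all y0 generic_shift[OF y0])
  have k0: "generic (\<lambda>l. k0_Ia \<gamma> f l $ i $ j \<noteq> 0)" for i j
    by (rule generic_mono[OF R]) (simp add: k0_Ia_nth dprod_gamma_nonzero[OF \<gamma>])
  have "reflection_eq \<gamma> (K_ansatz \<gamma> (k0_Ia \<gamma> f) k1)" using sol unfolding solves_with_def by blast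
  note R_nec = generic_conj[OF R reflection_ansatz_necessary[OF \<gamma> this k0]]
  \<comment> \<open>A contradiction at one good point suffices, in one arbitrary column p.\<close>
  obtain l where l: "?R l" and N: "\<forall>a p. k1 l $ a $ p = k1 l $ p $ p \<and>
      (k0_Ia \<gamma> f l $ a $ p - k1 l $ a $ p) * BK0 \<gamma> (k0_Ia \<gamma> f) l p a
      = k0_Ia \<gamma> f l $ a $ p * (k0_Ia \<gamma> f (shift \<gamma> l p) $ p $ p - k1 (shift \<gamma> l p) $ p $ p)"
    by (rule generic_exists[OF R_nec], elim conjE) (rule that, (intro conjI; assumption), assumption)
  note nec = N[THEN spec, THEN spec, THEN conjunct1] N[THEN spec, THEN spec, THEN conjunct2]
  define p :: 'n where "p = undefined"
  define y where "y a = f l + l $ a" for a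
  let ?P = "dprod (\<lambda>x. \<gamma> / x) l p" and ?S = "dprod (\<lambda>x. \<gamma> / x) (shift \<gamma> l p) p"
  have nd: "nondegenerate \<gamma> l" using l by blast
  \<comment> \<open>Both nonvanishing claims concern the same denominator: the second is its value
    after the shift in direction p, and it normalizes \<open>BK0\<close> below.\<close>
  have y: "y p \<noteq> 0" "y p + \<gamma> \<noteq> 0"
  proof -
    show "y p \<noteq> 0" using l unfolding y_def by blast
    have "f (shift \<gamma> l p) + shift \<gamma> l p $ p \<noteq> 0" "f (shift \<gamma> l p) = f l" using l by blast+
    then show "y p + \<gamma> \<noteq> 0" by (simp add: y_def shift_nth add.assoc)
  qed
  have k: "k0_Ia \<gamma> f l $ a $ p = ?P / y p * y a" for a
    by (simp add: k0_Ia_def dprod_def y_def)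
  have ks: "k0_Ia \<gamma> f (shift \<gamma> l p) $ a $ p = ?S / (y p + \<gamma>) * (y a + (if a = p then \<gamma> else 0))" for a
  proof -
    have "f (shift \<gamma> l p) = f l" using l by blast
    then show ?thesis by (simp add: k0_Ia_def dprod_def y_def shift_nth add.assoc)
  qed
  have g: "BK0 \<gamma> (k0_Ia \<gamma> f) l p a = ?S / (y p + \<gamma>) * (y a + \<gamma>)" for a
  proof (cases "a = p")
    case True
    then show ?thesis using \<gamma> unfolding BK0_def ks by simp
  next
    case False
    have d: "l $ a - l $ p = y a - y p" by (simp add: y_def)
    have d': "l $ a - l $ p \<noteq> \<gamma>" using nd False unfolding nondegenerate_def by blast
    show ?thesis unfolding BK0_def ks
      using False BK0_linear[OF d d', of "?S / (y p + \<gamma>)"] by simp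
  qed
  show False
  proof (rule linear_column_contradiction[OF card, of y "?P / y p" "?S / (y p + \<gamma>)"])
    show "inj y" using nd unfolding nondegenerate_def inj_def y_def by force
    show "?P / y p \<noteq> 0" "?S / (y p + \<gamma>) \<noteq> 0" using y dprod_gamma_nonzero[OF \<gamma> nd] by auto
    show "(?P / y p * y a - k1 l $ p $ p) * (?S / (y p + \<gamma>) * (y a + \<gamma>))
        = ?P / y p * y a * (k0_Ia \<gamma> f (shift \<gamma> l p) $ p $ p - k1 (shift \<gamma> l p) $ p $ p)" for a
      using nec(2)[of a p] unfolding nec(1)[of a p] g k .
  qed
qed

lemma k0_IIa_nth: "k0_IIa \<gamma> f l $ i $ j = (f l - Lam2 l i j) * dprod (\<lambda>x. \<gamma> / x) l j"
  by (simp add: k0_IIa_def dprod_def)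

lemma type_IIa:
  fixes f :: "complex^'n::finite \<Rightarrow> complex"
  assumes card: "CARD('n) \<ge> 3" and \<gamma>: "\<gamma> \<noteq> 0" and mero: "meromorphic_Cn f"
    and per: "\<forall>i. generic (\<lambda>l. f (shift \<gamma> l i) = f l)" and nze: "no_zero_entry (k0_IIa \<gamma> f)"
  shows "\<not> solves_with \<gamma> (k0_IIa \<gamma> f) k1"
proof
  assume sol: "solves_with \<gamma> (k0_IIa \<gamma> f) k1"
  have y0: "generic (\<lambda>l. f l - Lam2 l i j \<noteq> 0)" for i j
  proof (rule generic_not_zero)
    show "meromorphic_Cn (\<lambda>l. f l - Lam2 l i j)"
      by (intro meromorphic_Cn_diff mero meromorphic_Cn_Lam2)
    show "\<not> generic (\<lambda>l. f l - Lam2 l i j = 0)"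
    proof
      assume "generic (\<lambda>l. f l - Lam2 l i j = 0)"
      then have "generic (\<lambda>l. k0_IIa \<gamma> f l $ i $ j = 0)"
        by (rule generic_mono) (simp add: k0_IIa_def)
      then show False using nze unfolding no_zero_entry_def by blast
    qed
  qed
  have per': "generic (\<lambda>l. \<forall>i. f (shift \<gamma> l i) = f l)" using per by (intro generic_all) blast
  let ?R = "\<lambda>l. nondegenerate \<gamma> l \<and> (\<forall>p. f (shift \<gamma> l p) = f l) \<and> (\<forall>i j. f l - Lam2 l i j \<noteq> 0)"
  have R: "generic ?R"
    by (intro generic_conj generic_nondegenerate per' generic_all y0)
  have k0: "generic (\<lambda>l. k0_IIa \<gamma> f l $ i $ j \<noteq> 0)" for i j
    by (rule generic_mono[OF R]) (simp add: k0_IIa_nth dprod_gamma_nonzero[OF \<gamma>])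
  have "reflection_eq \<gamma> (K_ansatz \<gamma> (k0_IIa \<gamma> f) k1)" using sol unfolding solves_with_def by blast
  note R_nec = generic_conj[OF R reflection_ansatz_necessary[OF \<gamma> this k0]]
  obtain l where l: "?R l" and N: "\<forall>a p. k1 l $ a $ p = k1 l $ p $ p \<and>
      (k0_IIa \<gamma> f l $ a $ p - k1 l $ a $ p) * BK0 \<gamma> (k0_IIa \<gamma> f) l p a
      = k0_IIa \<gamma> f l $ a $ p * (k0_IIa \<gamma> f (shift \<gamma> l p) $ p $ p - k1 (shift \<gamma> l p) $ p $ p)"
    by (rule generic_exists[OF R_nec], elim conjE) (rule that, (intro conjI; assumption), assumption)
  note nec = N[THEN spec, THEN spec, THEN conjunct1] N[THEN spec, THEN spec, THEN conjunct2]
  define p :: 'n where "p = undefined"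
  define y where "y a = f l - Lam2 l a p" for a
  let ?P = "dprod (\<lambda>x. \<gamma> / x) l p" and ?S = "dprod (\<lambda>x. \<gamma> / x) (shift \<gamma> l p) p"
  have nd: "nondegenerate \<gamma> l" using l by blast
  have k: "k0_IIa \<gamma> f l $ a $ p = ?P * y a" for a
    by (simp add: k0_IIa_def dprod_def y_def)
  have ks: "k0_IIa \<gamma> f (shift \<gamma> l p) $ a $ p = ?S * (y a + (if a = p then \<gamma> else 0))" for a
  proof -
    have "f (shift \<gamma> l p) = f l" using l by blast
    then show ?thesis by (simp add: k0_IIa_def dprod_def y_def Lam2_shift)
  qed
  have yd: "y a - y b = l $ a - l $ b" for a b by (simp add: y_def Lam2_def)
  have g: "BK0 \<gamma> (k0_IIa \<gamma> f) l p a = ?S * (y a + \<gamma>)" for a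
  proof (cases "a = p")
    case True
    then show ?thesis using \<gamma> unfolding BK0_def ks by simp
  next
    case False
    have d': "l $ a - l $ p \<noteq> \<gamma>" using nd False unfolding nondegenerate_def by blast
    show ?thesis unfolding BK0_def ks
      using False BK0_linear[OF yd[symmetric] d', of ?S] by simp
  qed
  show False
  proof (rule linear_column_contradiction[OF card, of y ?P ?S])
    show "inj y"
    proof (rule injI)
      fix a b assume "y a = y b"
      then have "l $ a - l $ b = 0" using yd[of a b] by simp
      then show "a = b" using nd unfolding nondegenerate_def by blast
    qed
    show "?P \<noteq> 0" "?S \<noteq> 0" using dprod_gamma_nonzero[OF \<gamma> nd] by auto
    show "(?P * y a - k1 l $ p $ p) * (?S * (y a + \<gamma>))
        = ?P * y a * (k0_IIa \<gamma> f (shift \<gamma> l p) $ p $ p - k1 (shift \<gamma> l p) $ p $ p)" for a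
      using nec(2)[of a p] unfolding nec(1)[of a p] g k .
  qed
qed

theorem mainTheorem1:
  fixes \<gamma> :: complex and f :: "complex^'n::finite \<Rightarrow> complex"
  assumes "CARD('n) \<ge> 2"
    and "\<gamma> \<noteq> 0"
    and "meromorphic_Cn f"
    and "\<forall>i. generic (\<lambda>l. f (shift \<gamma> l i) = f l)"
  shows
    "(no_zero_entry (k0_Ib \<gamma> f) \<longrightarrow>
        (\<exists>k1. solves_with \<gamma> (k0_Ib \<gamma> f) k1
            \<and> (\<forall>k1'. solves_with \<gamma> (k0_Ib \<gamma> f) k1' \<longrightarrow> generic (\<lambda>l. k1' l = k1 l))
            \<and> generic (\<lambda>(u, l). K_ansatz \<gamma> (k0_Ib \<gamma> f) k1 u l = K_Ib \<gamma> f u l)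
            \<and> no_zero_column k1))
     \<and> (no_zero_entry (k0_IIb f) \<longrightarrow>
        (\<exists>k1. solves_with \<gamma> (k0_IIb f) k1
            \<and> (\<forall>k1'. solves_with \<gamma> (k0_IIb f) k1' \<longrightarrow> generic (\<lambda>l. k1' l = k1 l))
            \<and> generic (\<lambda>(u, l). K_ansatz \<gamma> (k0_IIb f) k1 u l = K_IIb f u l)
            \<and> no_zero_column k1))
     \<and> (CARD('n) \<ge> 3 \<longrightarrow> no_zero_entry (k0_Ia \<gamma> f) \<longrightarrow>
        \<not> (\<exists>k1. solves_with \<gamma> (k0_Ia \<gamma> f) k1))
     \<and> (CARD('n) \<ge> 3 \<longrightarrow> no_zero_entry (k0_IIa \<gamma> f) \<longrightarrow>
        \<not> (\<exists>k1. solves_with \<gamma> (k0_IIa \<gamma> f) k1))"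
proof (intro conjI impI)
  assume nze: "no_zero_entry (k0_Ib \<gamma> f)"
  have "generic (\<lambda>(u, l). K_ansatz \<gamma> (k0_Ib \<gamma> f) (k1_Ib \<gamma> f) u l = K_Ib \<gamma> f u l)"
    unfolding K_ansatz_k1_Ib[OF assms(2)] by (simp add: generic_True case_prod_unfold)
  then show "\<exists>k1. solves_with \<gamma> (k0_Ib \<gamma> f) k1
            \<and> (\<forall>k1'. solves_with \<gamma> (k0_Ib \<gamma> f) k1' \<longrightarrow> generic (\<lambda>l. k1' l = k1 l))
            \<and> generic (\<lambda>(u, l). K_ansatz \<gamma> (k0_Ib \<gamma> f) k1 u l = K_Ib \<gamma> f u l)
            \<and> no_zero_column k1"
    using type_Ib[OF assms nze] by blast
next
  assume nze: "no_zero_entry (k0_IIb f)"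
  have "generic (\<lambda>(u, l). K_ansatz \<gamma> (k0_IIb f) (k1_IIb \<gamma> f) u l = K_IIb f u l)"
    unfolding K_ansatz_k1_IIb[OF assms(2)] by (simp add: generic_True case_prod_unfold)
  then show "\<exists>k1. solves_with \<gamma> (k0_IIb f) k1
            \<and> (\<forall>k1'. solves_with \<gamma> (k0_IIb f) k1' \<longrightarrow> generic (\<lambda>l. k1' l = k1 l))
            \<and> generic (\<lambda>(u, l). K_ansatz \<gamma> (k0_IIb f) k1 u l = K_IIb f u l)
            \<and> no_zero_column k1"
    using type_IIb[OF assms nze] by blast
next
  assume "CARD('n) \<ge> 3" "no_zero_entry (k0_Ia \<gamma> f)"
  then show "\<not> (\<exists>k1. solves_with \<gamma> (k0_Ia \<gamma> f) k1)" using type_Ia assms by blast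
next
  assume "CARD('n) \<ge> 3" "no_zero_entry (k0_IIa \<gamma> f)"
  then show "\<not> (\<exists>k1. solves_with \<gamma> (k0_IIa \<gamma> f) k1)" using type_IIa assms by blast
qed

end
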